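(* Let $d\geq 1$ be an integer. The following inequalities hold: (i) $\delta(d,k)\leq kd-\lceil 2d/3\rceil-(k-2)$ for every integer $k\geq 4$; (ii) $\delta(d,3)\leq \lfloor 7d/3\rfloor-1$ when $d\not\equiv 2 \pmod 3$; (iii) $\delta(d,3)\leq \lfloor 7d/3\rfloor$ when $d\equiv 2 \pmod 3$.
   Context: For integers $d\geq 1$, $k\geq 1$, a lattice $(d,k)$-polytope is the convex hull in $\mathbb{R}^d$ of a nonempty set of points of $\mathbb{Z}^d$ all of whose vertices belong to $\{0,1,\dots,k\}^d$ (it need not be full-dimensional). The graph of a polytope $P$ has as its nodes the vertices of $P$ and as its edges the pairs of vertices joined by a one-dimensional face of $P$. The diameter $\delta(P)$ of $P$ is the diameter of its graph (the largest graph distance between two vertices). The quantity $\delta(d,k)$ is the largest value of $\delta(P)$ over all lattice $(d,k)$-polytopes $P$. *)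

theory Defs
  imports "HOL-Analysis.Analysis"
begin

(* The ambient space R^d is real ^ 'n with d = CARD('n). The generating set is required to be
   finite, since the convex hull is meant to be a polytope: without this, Z^d itself, whose
   convex hull has no vertices, would qualify. *)
definition lattice_polytope :: "nat \<Rightarrow> (real ^ 'n) set \<Rightarrow> bool" where
  "lattice_polytope k P \<longleftrightarrow>
     (\<exists>S. finite S \<and> S \<noteq> {} \<and> (\<forall>x\<in>S. \<forall>i. x $ i \<in> \<int>) \<and> P = convex hull S) \<and>
     (\<forall>v. v extreme_point_of P \<longrightarrow> (\<forall>i. v $ i \<in> real ` {0..k}))"

definition polytope_vertices :: "(real ^ 'n) set \<Rightarrow> (real ^ 'n) set" where
  "polytope_vertices P = {v. v extreme_point_of P}"

definition polytope_edges :: "(real ^ 'n) set \<Rightarrow> ((real ^ 'n) \<times> (real ^ 'n)) set" where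
  "polytope_edges P =
     {(u, v). u \<in> polytope_vertices P \<and> v \<in> polytope_vertices P \<and> u \<noteq> v \<and>
              closed_segment u v edge_of P}"

(* Infinite when v cannot be reached from u, because Inf {} = \<infinity> in enat. *)
definition graph_distance :: "('a \<times> 'a) set \<Rightarrow> 'a \<Rightarrow> 'a \<Rightarrow> enat" where
  "graph_distance E u v = Inf {enat n | n. (u, v) \<in> E ^^ n}"

definition graph_diameter :: "'a set \<Rightarrow> ('a \<times> 'a) set \<Rightarrow> enat" where
  "graph_diameter V E = (SUP (u, v) \<in> V \<times> V. graph_distance E u v)"

definition polytope_diameter :: "(real ^ 'n) set \<Rightarrow> enat" where
  "polytope_diameter P = graph_diameter (polytope_vertices P) (polytope_edges P)"

(* \<delta>(d,k) for d = CARD('n). The supremum is a maximum: see finite_lattice_polytopes and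
   delta_attained. *)
definition delta :: "'n::finite itself \<Rightarrow> nat \<Rightarrow> enat" where
  "delta _ k = (SUP P \<in> {P :: (real ^ 'n) set. lattice_polytope k P}. polytope_diameter P)"

lemma finite_lattice_polytopes: "finite {P :: (real ^ 'n) set. lattice_polytope k P}"
proof (rule finite_subset)
  let ?G = "{x :: real ^ 'n. \<forall>i. x $ i \<in> real ` {0..k}}"
  have "?G \<subseteq> (\<lambda>f. \<chi> i. f i) ` (UNIV \<rightarrow>\<^sub>E real ` {0..k})"
  proof
    fix x assume "x \<in> ?G"
    then have "(\<lambda>i. x $ i) \<in> UNIV \<rightarrow>\<^sub>E real ` {0..k}"
      by (auto simp: PiE_UNIV_domain)
    moreover have "x = (\<chi> i. x $ i)" by simp
    ultimately show "x \<in> (\<lambda>f. \<chi> i. f i) ` (UNIV \<rightarrow>\<^sub>E real ` {0..k})"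
      by (metis (no_types, lifting) image_eqI)
  qed
  then have "finite ?G"
    by (rule finite_subset) (auto intro!: finite_imageI finite_PiE)
  then show "finite ((hull) convex ` Pow ?G)" by simp
  show "{P. lattice_polytope k P} \<subseteq> (hull) convex ` Pow ?G"
  proof
    fix P assume "P \<in> {P :: (real ^ 'n) set. lattice_polytope k P}"
    then obtain S where S: "finite S" "P = convex hull S"
      and v: "\<And>v. v extreme_point_of P \<Longrightarrow> v \<in> ?G"
      unfolding lattice_polytope_def by blast
    have "P = convex hull {v. v extreme_point_of P}"
      using S by (intro Krein_Milman_Minkowski)
        (auto intro: compact_convex_hull finite_imp_compact)
    then show "P \<in> (hull) convex ` Pow ?G" using v by blast
  qed
qed

lemma delta_attained:
  "\<exists>P :: (real ^ 'n) set. lattice_polytope k P \<and> delta TYPE('n) k = polytope_diameter P"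
proof -
  let ?A = "polytope_diameter ` {P :: (real ^ 'n) set. lattice_polytope k P}"
  have "lattice_polytope k {0 :: real ^ 'n}"
    unfolding lattice_polytope_def by (auto intro!: exI[of _ "{0}"] simp: extreme_point_of_def)
  then have ne: "?A \<noteq> {}" by blast
  have fin: "finite ?A" using finite_lattice_polytopes by (rule finite_imageI)
  have "Sup ?A = Max ?A" using fin ne by (rule Max_Sup[symmetric])
  then have "Sup ?A \<in> ?A" using Max_in[OF fin ne] by simp
  then show ?thesis unfolding delta_def by auto
qed

end

theory Submission
  imports Defs
begin

text \<open>
  Let \<open>\<delta>(d)\<close> bound the diameter of the polytopes that have at most \<open>d\<close> non-constant coordinates. A
  face of such a polytope is again one, and it is covered by \<open>\<delta>(d - 1)\<close> if one more coordinate is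
  constant on it.

  Vertices are integral, so an edge that moves a vertex towards a side \<open>x\<^sub>i = 0\<close> or \<open>x\<^sub>i = k\<close> of the
  cube lowers the distance to this side, called the \<^emph>\<open>room\<close> at \<open>i\<close>, by at least one, and such an edge
  exists as long as \<open>P\<close> has a point closer to the side (\<open>improving_edge\<close>). Hence \<open>u\<close> and \<open>v\<close> meet the
  same face after at most \<open>k\<close> steps in total, if the better one of two opposite sides is chosen:
  \<open>\<delta>(d) \<le> \<delta>(d - 1) + k\<close>. The same walk for the sum of the rooms over a set \<open>S\<close> of at most
  three coordinates costs at most \<open>|S| k\<close> steps when \<open>u + v = (k, \<dots>, k)\<close> and leaves
  \<open>\<delta>(d - |S|)\<close> (\<open>reaches_via_corner\<close>).

  Each step that lowers such a sum by more than one saves a step. Therefore, if the distance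
  of \<open>u\<close> and \<open>v\<close> exceeds each of \<open>\<delta>(d - 1) + k - 1\<close>, \<open>\<delta>(d - 2) + 2k - 2\<close> and
  \<open>\<delta>(d - 3) + 3k - 2\<close>, then \<open>n\<close> steps, made from \<open>u\<close> and from \<open>v\<close> together, lower a
  single room by at most \<open>n\<close> and a sum of two or three rooms by at most \<open>n + 1\<close>. This is
  contradictory for \<open>d \<ge> 3\<close> and \<open>k \<ge> 3\<close> (\<open>no_spread_vertices\<close>): once one step has been
  saved on two coordinates \<open>i\<close>, \<open>j\<close>, the bound for three coordinates forces all further steps towards
  the corner of \<open>i\<close> and \<open>j\<close> to lie in the plane of these two coordinates and to lower the sum of the
  two rooms by exactly one. The edges of such a planar walk turn in one sense (\<open>turns_agree\<close>),
  which together with the bound for single rooms allows only a few steps, fewer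
  than the \<open>2k\<close> by which the rooms have to shrink. A first saving always exists: an edge at
  \<open>u\<close> or \<open>v\<close> that is not parallel to an axis is one, and if all edges at \<open>u\<close> are
  parallel to axes, then \<open>u\<close> is a corner of the cube and the second edge of any walk towards a
  side gives one.

  Together with \<open>\<delta>(1) = 1\<close>, with \<open>\<delta>(2) \<le> k\<close> for \<open>k \<ge> 4\<close> (\<open>reaches_in_polygon\<close>) and
  with \<open>\<delta>(3) \<le> 6\<close> for \<open>k = 3\<close> (\<open>reaches_if_pairs_bounded\<close>), this shows
  \<open>\<delta>(d) \<le> \<delta>(d - 3) + 3k - 2\<close> for \<open>d \<ge> 4\<close> (\<open>diameter_bound_value\<close>),
  of which the three inequalities are the closed forms.
\<close>

section \<open>Improving edges\<close>

text \<open>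
  The step of the simplex algorithm, via the vertex figure: \<open>u\<close> is the unique
  maximum of some functional \<open>a\<close>, so \<open>P\<close> lies in the cone with apex \<open>u\<close> over a polytope \<open>Q\<close> of
  directions \<open>q\<close> with \<open>a \<bullet> q = - 1\<close>. As \<open>c\<close> increases somewhere on \<open>P\<close>, it is positive at an
  extreme point of \<open>Q\<close>, and the ray through an extreme point of \<open>Q\<close> cuts an edge out of \<open>P\<close>.
\<close>
lemma improving_edge:
  fixes P :: "(real ^ 'n) set"
  assumes P: "polytope P" and u: "u extreme_point_of P"
    and y: "y \<in> P" "c \<bullet> u < c \<bullet> y"
  obtains w where "(u, w) \<in> polytope_edges P" "c \<bullet> u < c \<bullet> w"
proof -
  have uP: "u \<in> P" using u by (simp add: extreme_point_of_def)
  have cP: "compact P" and convP: "convex P"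
    using P by (auto simp: polytope_imp_compact polytope_imp_convex)
  have "{u} face_of P" using u by (simp add: face_of_singleton)
  then have "{u} exposed_face_of P"
    using P by (simp add: exposed_face_of_polyhedron polytope_imp_polyhedron)
  then obtain a b where ab: "P \<subseteq> {x. a \<bullet> x \<le> b}" "{u} = P \<inter> {x. a \<bullet> x = b}"
    unfolding exposed_face_of_def by auto
  have au: "a \<bullet> u = b" using ab by auto
  define h where "h x = b - a \<bullet> x" for x
  have h0: "h x \<ge> 0" if "x \<in> P" for x using ab that by (auto simp: h_def)
  have hpos: "h x > 0" if "x \<in> P" "x \<noteq> u" for x
    using ab that h0[OF that(1)] unfolding h_def by (smt (verit) IntI mem_Collect_eq singletonD)
  define V where "V = {v. v extreme_point_of P} - {u}"
  define dir where "dir x = (1 / h x) *\<^sub>R (x - u)" for x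
  have finV: "finite V"
    unfolding V_def using P by (simp add: finite_polyhedron_extreme_points polytope_imp_polyhedron)
  have VP: "v \<in> P" "v \<noteq> u" "h v > 0" if "v \<in> V" for v
    using that hpos by (auto simp: V_def extreme_point_of_def)
  define Q where "Q = convex hull (dir ` V)"
  have cQ: "compact Q" "convex Q"
    unfolding Q_def using finV by (auto intro: compact_convex_hull finite_imp_compact)
  have aQ: "a \<bullet> q = -1" if "q \<in> Q" for q
  proof -
    have "Q \<subseteq> {q. a \<bullet> q = -1}"
      unfolding Q_def
    proof (rule hull_minimal)
      show "dir ` V \<subseteq> {q. a \<bullet> q = - 1}"
      proof clarify
        fix v assume "v \<in> V"
        then have "h v > 0" by (rule VP)
        moreover have "a \<bullet> (v - u) = - h v" by (simp add: inner_diff_right au h_def)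
        ultimately show "a \<bullet> dir v = -1" by (simp add: dir_def)
      qed
    qed (rule convex_hyperplane)
    then show ?thesis using that by auto
  qed
  have ray: "\<exists>q\<in>Q. x = u + h x *\<^sub>R q" if "x \<in> P" "V \<noteq> {}" for x
  proof -
    have Qne: "Q \<noteq> {}" using that by (simp add: Q_def)
    have "P = convex hull {v. v extreme_point_of P}"
      using Krein_Milman_Minkowski[OF cP convP] .
    also have "\<dots> \<subseteq> (+) u ` (cone hull Q)"
    proof (rule hull_minimal)
      show "{v. v extreme_point_of P} \<subseteq> (+) u ` (cone hull Q)"
      proof
        fix v assume v: "v \<in> {v. v extreme_point_of P}"
        show "v \<in> (+) u ` (cone hull Q)"
        proof (cases "v = u")
          case True
          obtain q where "q \<in> Q" using Qne by blast
          then have "0 \<in> cone hull Q"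
            unfolding cone_hull_expl by (auto intro!: exI[of _ 0] exI[of _ q])
          then show ?thesis using True by (auto intro!: image_eqI[of _ _ 0])
        next
          case False
          then have vV: "v \<in> V" using v by (simp add: V_def)
          have "v - u = h v *\<^sub>R dir v" using VP(3)[OF vV] by (simp add: dir_def)
          moreover have "dir v \<in> Q" unfolding Q_def using vV by (simp add: hull_inc)
          ultimately have "v - u \<in> cone hull Q"
            unfolding cone_hull_expl using VP(3)[OF vV] by force
          then show ?thesis by (auto intro!: image_eqI[of _ _ "v - u"])
        qed
      qed
      show "convex ((+) u ` (cone hull Q))"
        using cQ by (intro convex_translation convex_cone_hull)
    qed
    finally obtain t q where tq: "x = u + t *\<^sub>R q" "q \<in> Q" using \<open>x \<in> P\<close>
      unfolding cone_hull_expl by auto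
    have "h x = t" using aQ[OF tq(2)] by (simp add: h_def tq inner_add_right au)
    then show ?thesis using tq by blast
  qed
  have Vne: "V \<noteq> {}"
  proof
    assume "V = {}"
    then have "{v. v extreme_point_of P} \<subseteq> {u}" by (auto simp: V_def)
    then have "convex hull {v. v extreme_point_of P} \<subseteq> {u}"
      by (metis convex_hull_singleton hull_mono)
    then have "y = u" using Krein_Milman_Minkowski[OF cP convP] y by auto
    then show False using y by simp
  qed
  have "\<exists>q. q extreme_point_of Q \<and> c \<bullet> q > 0"
  proof (rule ccontr)
    assume no: "\<not> ?thesis"
    have "Q = convex hull {q. q extreme_point_of Q}"
      using Krein_Milman_Minkowski[OF cQ] .
    also have "\<dots> \<subseteq> {q. c \<bullet> q \<le> 0}"
      using no by (intro hull_minimal) (auto simp: convex_halfspace_le not_less)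
    finally have Qle: "Q \<subseteq> {q. c \<bullet> q \<le> 0}" .
    obtain q where q: "q \<in> Q" "y = u + h y *\<^sub>R q" using ray[OF y(1) Vne] by blast
    have "c \<bullet> y = c \<bullet> u + h y * (c \<bullet> q)" by (subst q(2)) (simp add: inner_add_right)
    moreover have "h y * (c \<bullet> q) \<le> 0"
      using h0[OF y(1)] Qle q(1) by (auto intro: mult_nonneg_nonpos)
    ultimately show False using y(2) by simp
  qed
  then obtain q where q: "q extreme_point_of Q" "c \<bullet> q > 0" by blast
  then have "q \<in> dir ` V" unfolding Q_def by (blast intro: extreme_point_of_convex_hull)
  then obtain w where w: "w \<in> V" "q = dir w" by blast
  have hw: "h w > 0" using VP(3)[OF w(1)] .
  have weq: "w = u + h w *\<^sub>R q" using hw w by (simp add: dir_def)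
  have wext: "w extreme_point_of P" and wP: "w \<in> P" using w VP by (auto simp: V_def)
  \<comment> \<open>\<open>P\<close> cannot extend beyond \<open>w\<close> on the ray, because \<open>w\<close> is itself a vertex.\<close>
  have on_ray: "x \<in> closed_segment u w" if "x \<in> P" "x = u + t *\<^sub>R q" "t \<ge> 0" for x t
  proof (cases "t \<le> h w")
    case True
    have "x = (1 - t / h w) *\<^sub>R u + (t / h w) *\<^sub>R w"
      using hw by (subst weq) (simp add: that(2) algebra_simps)
    moreover have "0 \<le> t / h w" "t / h w \<le> 1" using True hw that by auto
    ultimately show ?thesis unfolding in_segment by blast
  next
    case False
    then have t: "t > 0" using hw by simp
    have "w = (1 - h w / t) *\<^sub>R u + (h w / t) *\<^sub>R x"
      using t by (subst weq) (simp add: that(2) algebra_simps)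
    moreover have "0 < h w / t" "h w / t < 1" using False hw t by auto
    moreover have "u \<noteq> x" using that(2) t q by auto
    ultimately have "w \<in> open_segment u x" unfolding in_segment by blast
    then show ?thesis using wext that(1) uP by (auto simp: extreme_point_of_def)
  qed
  have "closed_segment u w face_of P"
    unfolding face_of_def
  proof (intro conjI ballI impI)
    show "closed_segment u w \<subseteq> P" using uP wP convP by (simp add: closed_segment_subset)
    show "convex (closed_segment u w)" by (rule convex_closed_segment)
    fix x1 x2 x assume x1: "x1 \<in> P" and x2: "x2 \<in> P"
      and x: "x \<in> closed_segment u w" "x \<in> open_segment x1 x2"
    have xP: "x \<in> P" using x(1) uP wP convP closed_segment_subset by blast
    have xu: "x \<noteq> u" using u x x1 x2 by (auto simp: extreme_point_of_def)
    then have hx: "h x > 0" using hpos xP by blast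
    obtain e where e: "x = (1 - e) *\<^sub>R u + e *\<^sub>R w" using x(1) unfolding in_segment by blast
    have xq: "x = u + (e * h w) *\<^sub>R q" unfolding e by (subst weq) (simp add: algebra_simps)
    have qQ: "q \<in> Q" using q(1) by (simp add: extreme_point_of_def)
    have "h x = e * h w" using aQ[OF qQ] by (simp add: h_def inner_add_right au xq)
    then have xq: "x = u + h x *\<^sub>R q" using xq by simp
    obtain r where r: "0 < r" "r < 1" "x = (1 - r) *\<^sub>R x1 + r *\<^sub>R x2"
      using x(2) unfolding in_segment by blast
    obtain q1 where q1: "q1 \<in> Q" "x1 = u + h x1 *\<^sub>R q1" using ray[OF x1 Vne] by blast
    obtain q2 where q2: "q2 \<in> Q" "x2 = u + h x2 *\<^sub>R q2" using ray[OF x2 Vne] by blast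
    have hsum: "h x = (1 - r) * h x1 + r * h x2"
      by (simp add: h_def r(3) inner_add_right algebra_simps)
    have "h x *\<^sub>R q = x - u" using xq by (metis add_diff_cancel_left')
    also have "\<dots> = (1 - r) *\<^sub>R (x1 - u) + r *\<^sub>R (x2 - u)" by (simp add: r(3) algebra_simps)
    also have "x1 - u = h x1 *\<^sub>R q1" using q1(2) by (metis add_diff_cancel_left')
    also have "x2 - u = h x2 *\<^sub>R q2" using q2(2) by (metis add_diff_cancel_left')
    finally have comb: "h x *\<^sub>R q = ((1 - r) * h x1) *\<^sub>R q1 + (r * h x2) *\<^sub>R q2"
      by (simp add: algebra_simps)
    have goal: "x1 \<in> closed_segment u w \<and> x2 \<in> closed_segment u w"
      if "h x1 = 0 \<or> q1 = q" "h x2 = 0 \<or> q2 = q"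
    proof -
      have "x1 = u + h x1 *\<^sub>R q" "x2 = u + h x2 *\<^sub>R q"
        using that q1(2) q2(2) by (metis scaleR_zero_left)+
      then show ?thesis using on_ray x1 x2 h0 by blast
    qed
    have "x1 \<in> closed_segment u w \<and> x2 \<in> closed_segment u w"
    proof (cases "h x1 = 0 \<or> h x2 = 0")
      case True
      then have "(h x1 = 0 \<and> q2 = q) \<or> (h x2 = 0 \<and> q1 = q)"
        using comb hsum hx by auto
      then show ?thesis using goal by blast
    next
      case False
      then have pos: "h x1 > 0" "h x2 > 0" using h0 x1 x2 by (auto simp: less_le)
      define s where "s = r * h x2 / h x"
      have "0 < s" unfolding s_def using pos(2) hx r(1) by simp
      moreover have "1 - s = (1 - r) * h x1 / h x"
        unfolding s_def using hx hsum by (simp add: field_simps)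
      ultimately have s: "0 < s" "1 - s = (1 - r) * h x1 / h x" .
      have "s < 1" using s(2) pos hx r by (smt (verit) divide_pos_pos mult_pos_pos)
      have "q = (1 / h x) *\<^sub>R (h x *\<^sub>R q)" using hx by simp
      also have "\<dots> = (1 - s) *\<^sub>R q1 + s *\<^sub>R q2"
        unfolding comb s(2) by (simp add: s_def scaleR_add_right)
      finally have "q = (1 - s) *\<^sub>R q1 + s *\<^sub>R q2" .
      then have "q1 = q2 \<or> q \<in> open_segment q1 q2"
        using s \<open>s < 1\<close> unfolding in_segment by blast
      moreover have "q \<notin> open_segment q1 q2" using q(1) q1 q2 by (auto simp: extreme_point_of_def)
      ultimately have "q1 = q2" by blast
      then have "q = q1" using \<open>q = (1 - s) *\<^sub>R q1 + s *\<^sub>R q2\<close> by (simp add: algebra_simps)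
      then show ?thesis using goal \<open>q1 = q2\<close> by blast
    qed
    then show "x1 \<in> closed_segment u w" "x2 \<in> closed_segment u w" by auto
  qed
  moreover have "u \<noteq> w" using VP w by blast
  ultimately have "(u, w) \<in> polytope_edges P"
    using u wext by (simp add: polytope_edges_def polytope_vertices_def edge_of_def segment_convex_hull aff_dim_convex_hull aff_dim_2)
  moreover have "c \<bullet> u < c \<bullet> w"
    using hw q(2) by (subst weq) (simp add: inner_add_right)
  ultimately show ?thesis using that by blast
qed

section \<open>Walks in the graph of a polytope\<close>

definition reaches :: "('a \<times> 'a) set \<Rightarrow> nat \<Rightarrow> 'a \<Rightarrow> 'a \<Rightarrow> bool" where
  "reaches E n u v \<longleftrightarrow> (\<exists>m\<le>n. (u, v) \<in> E ^^ m)"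

lemma reaches_refl: "reaches E n u u"
  unfolding reaches_def by (rule exI[of _ 0]) simp

lemma relpow_mono_set:
  fixes E :: "('a \<times> 'a) set"
  shows "E \<subseteq> E' \<Longrightarrow> E ^^ m \<subseteq> E' ^^ m"
  by (induction m) auto

lemma relpow_sym: "sym E \<Longrightarrow> (u, v) \<in> E ^^ m \<Longrightarrow> (v, u) \<in> E ^^ m"
proof (induction m arbitrary: v)
  case (Suc m)
  then obtain w where "(u, w) \<in> E ^^ m" "(w, v) \<in> E" by auto
  then show ?case using Suc by (intro relpow_Suc_I2[of v w]) (auto dest: symD)
qed auto

lemma reaches_mono: "reaches E m u v \<Longrightarrow> m \<le> n \<Longrightarrow> E \<subseteq> E' \<Longrightarrow> reaches E' n u v"
  unfolding reaches_def by (meson order_trans relpow_mono_set subsetD)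

lemma reaches_trans: "reaches E m u v \<Longrightarrow> reaches E n v w \<Longrightarrow> reaches E (m + n) u w"
  unfolding reaches_def by (blast intro: add_mono relpow_trans)

lemma reaches_step: "(u, v) \<in> E \<Longrightarrow> reaches E n v w \<Longrightarrow> reaches E (Suc n) u w"
  unfolding reaches_def by (blast intro: relpow_Suc_I2 Suc_le_mono[THEN iffD2])

lemma reaches_sym: "sym E \<Longrightarrow> reaches E n u v \<Longrightarrow> reaches E n v u"
  unfolding reaches_def by (blast intro: relpow_sym)

lemma graph_diameter_le:
  assumes "\<And>u v. u \<in> V \<Longrightarrow> v \<in> V \<Longrightarrow> reaches E n u v"
  shows "graph_diameter V E \<le> enat n"
  unfolding graph_diameter_def
proof (rule SUP_least, clarify)
  fix u v assume "u \<in> V" "v \<in> V"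
  then obtain m where "m \<le> n" "(u, v) \<in> E ^^ m"
    using assms unfolding reaches_def by blast
  then show "graph_distance E u v \<le> enat n"
    unfolding graph_distance_def by (intro Inf_lower2[of "enat m"]) auto
qed

lemma sym_polytope_edges: "sym (polytope_edges P)"
  by (auto simp: sym_def polytope_edges_def closed_segment_commute)

lemma polytope_vertices_subset: "polytope_vertices P \<subseteq> P"
  by (auto simp: polytope_vertices_def extreme_point_of_def)

lemma polytope_vertices_face:
  "F face_of P \<Longrightarrow> polytope_vertices F = polytope_vertices P \<inter> F"
  by (auto simp: polytope_vertices_def extreme_point_of_face)

lemma polytope_edges_face: "F face_of P \<Longrightarrow> polytope_edges F \<subseteq> polytope_edges P"
  using face_of_trans[of _ F P] polytope_vertices_face[of F P]
  unfolding polytope_edges_def edge_of_def by blast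

lemma finite_polytope_vertices: "polytope P \<Longrightarrow> finite (polytope_vertices P)"
  by (simp add: polytope_vertices_def finite_polyhedron_extreme_points polytope_imp_polyhedron)

section \<open>Rooms\<close>

text \<open>
  Induction on the dimension runs over the set \<open>I\<close> of coordinates that may vary, inside a fixed
  space, so that faces need not be projected to a space of lower dimension.
\<close>
definition cube_polytope :: "nat \<Rightarrow> 'n set \<Rightarrow> (real ^ 'n) set \<Rightarrow> bool" where
  "cube_polytope k I P \<longleftrightarrow> polytope P \<and>
     (\<forall>v\<in>polytope_vertices P. \<forall>i. v $ i \<in> real ` {0..k}) \<and>
     (\<forall>v\<in>polytope_vertices P. \<forall>w\<in>polytope_vertices P. \<forall>i. i \<notin> I \<longrightarrow> v $ i = w $ i)"

text \<open>
  The distance of \<open>v\<close> to the side \<open>x\<^sub>i = k\<close> or \<open>x\<^sub>i = 0\<close> of the cube, as selected by \<open>\<sigma> i\<close>.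
  Quantifying over \<open>\<sigma>\<close> replaces the reflections of the cube in arguments by symmetry.
\<close>
definition room :: "nat \<Rightarrow> ('n \<Rightarrow> bool) \<Rightarrow> real ^ 'n \<Rightarrow> 'n \<Rightarrow> int" where
  "room k \<sigma> v i = (if \<sigma> i then int k - \<lfloor>v $ i\<rfloor> else \<lfloor>v $ i\<rfloor>)"

definition total_room :: "nat \<Rightarrow> ('n \<Rightarrow> bool) \<Rightarrow> 'n set \<Rightarrow> real ^ 'n \<Rightarrow> int" where
  "total_room k \<sigma> S v = (\<Sum>i\<in>S. room k \<sigma> v i)"

definition diameter_bound :: "nat \<Rightarrow> 'n::finite set \<Rightarrow> nat \<Rightarrow> bool" where
  "diameter_bound k I B \<longleftrightarrow> (\<forall>P. cube_polytope k I P \<longrightarrow>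
     (\<forall>u\<in>polytope_vertices P. \<forall>v\<in>polytope_vertices P. reaches (polytope_edges P) B u v))"

lemma cube_polytope_face:
  "cube_polytope k I P \<Longrightarrow> F face_of P \<Longrightarrow> cube_polytope k I F"
  unfolding cube_polytope_def polytope_vertices_face[of F P]
  using face_of_polytope_polytope[of P F] polytope_vertices_face[of F P] by simp

lemma cube_polytope_coordinate:
  assumes "cube_polytope k I P" "v \<in> polytope_vertices P"
  obtains m where "m \<le> k" "v $ i = real m"
proof -
  have "v $ i \<in> real ` {0..k}" using assms by (simp add: cube_polytope_def)
  then show ?thesis using that by auto
qed

lemma room_eq:
  assumes "cube_polytope k I P" "v \<in> polytope_vertices P"
  shows "of_int (room k \<sigma> v i) = (if \<sigma> i then real k - v $ i else v $ i)"
proof -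
  obtain m where "v $ i = real m" using cube_polytope_coordinate[OF assms] .
  then show ?thesis by (simp add: room_def)
qed

lemma room_range:
  assumes "cube_polytope k I P" "v \<in> polytope_vertices P"
  shows "0 \<le> room k \<sigma> v i" "room k \<sigma> v i \<le> int k"
proof -
  obtain m where "m \<le> k" "v $ i = real m" using cube_polytope_coordinate[OF assms] .
  then show "0 \<le> room k \<sigma> v i" "room k \<sigma> v i \<le> int k" by (auto simp: room_def)
qed

lemma room_decreases_towards:
  assumes "cube_polytope k I P" "v \<in> polytope_vertices P" "w \<in> polytope_vertices P"
    and "w $ i \<noteq> v $ i"
  shows "room k (\<lambda>l. v $ l < w $ l) w i < room k (\<lambda>l. v $ l < w $ l) v i"
proof -
  have "real_of_int (room k (\<lambda>l. v $ l < w $ l) w i) < real_of_int (room k (\<lambda>l. v $ l < w $ l) v i)"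
    unfolding room_eq[OF assms(1,2)] room_eq[OF assms(1,3)] using assms(4) by auto
  then show ?thesis by simp
qed

lemma room_eq_iff:
  assumes "cube_polytope k I P" "v \<in> polytope_vertices P" "w \<in> polytope_vertices P"
  shows "room k \<sigma> v i = room k \<sigma> w i \<longleftrightarrow> v $ i = w $ i"
proof -
  have "real_of_int (room k \<sigma> v i) = real_of_int (room k \<sigma> w i) \<longleftrightarrow> v $ i = w $ i"
    by (simp add: room_eq[OF assms(1,2)] room_eq[OF assms(1,3)] del: of_int_eq_iff)
  then show ?thesis by simp
qed

text \<open>Up to a constant, the negated total room as a linear functional.\<close>
definition direction :: "('n \<Rightarrow> bool) \<Rightarrow> 'n set \<Rightarrow> real ^ 'n" where
  "direction \<sigma> S = (\<Sum>i\<in>S. (if \<sigma> i then 1 else - 1) *\<^sub>R axis i 1)"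

lemma inner_direction:
  fixes S :: "'n::finite set"
  assumes "cube_polytope k I P" "v \<in> polytope_vertices P"
  shows "direction \<sigma> S \<bullet> v = real (card {i\<in>S. \<sigma> i} * k) - of_int (total_room k \<sigma> S v)"
proof -
  have "direction \<sigma> S \<bullet> v = (\<Sum>i\<in>S. (if \<sigma> i then v $ i else - v $ i))"
    unfolding direction_def inner_sum_left by (intro sum.cong) (auto simp: inner_axis')
  also have "\<dots> = (\<Sum>i\<in>S. (if \<sigma> i then real k else 0) - of_int (room k \<sigma> v i))"
    by (intro sum.cong) (auto simp: room_eq[OF assms])
  also have "\<dots> = (\<Sum>i\<in>S. if \<sigma> i then real k else 0) - of_int (total_room k \<sigma> S v)"
    by (simp add: sum_subtractf total_room_def)
  also have "(\<Sum>i\<in>S. if \<sigma> i then real k else 0) = real (card {i\<in>S. \<sigma> i} * k)"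
    by (simp add: sum.If_cases Int_def)
  finally show ?thesis .
qed

lemma room_decreasing_edge:
  fixes S :: "'n::finite set"
  assumes P: "cube_polytope k I P" and "u \<in> polytope_vertices P" "y \<in> polytope_vertices P"
    and "total_room k \<sigma> S y < total_room k \<sigma> S u"
  obtains w where "(u, w) \<in> polytope_edges P" "w \<in> polytope_vertices P"
    "total_room k \<sigma> S w < total_room k \<sigma> S u"
proof -
  have "direction \<sigma> S \<bullet> u < direction \<sigma> S \<bullet> y"
    using assms(4) by (simp add: inner_direction[OF P] assms(2,3) del: of_int_sum)
  then obtain w where w: "(u, w) \<in> polytope_edges P" "direction \<sigma> S \<bullet> u < direction \<sigma> S \<bullet> w"
    using improving_edge[of P u y "direction \<sigma> S"] assms
    by (auto simp: polytope_vertices_def cube_polytope_def extreme_point_of_def)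
  then have "w \<in> polytope_vertices P" by (simp add: polytope_edges_def)
  then show ?thesis
    using that w by (simp add: inner_direction[OF P] assms(2) del: of_int_sum)
qed

definition least_room_face ::
    "nat \<Rightarrow> ('n::finite \<Rightarrow> bool) \<Rightarrow> 'n set \<Rightarrow> (real ^ 'n) set \<Rightarrow> (real ^ 'n) set \<Rightarrow> real ^ 'n \<Rightarrow> bool"
  where "least_room_face k \<sigma> S P F y \<longleftrightarrow> F face_of P \<and> y \<in> polytope_vertices F \<and>
    polytope_vertices F =
      {v \<in> polytope_vertices P. total_room k \<sigma> S v = total_room k \<sigma> S y} \<and>
    (\<forall>v\<in>polytope_vertices P. total_room k \<sigma> S y \<le> total_room k \<sigma> S v)"

lemma least_room_face_exists:
  fixes S :: "'n::finite set"
  assumes P: "cube_polytope k I P" and u: "u \<in> polytope_vertices P"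
  obtains F y where "least_room_face k \<sigma> S P F y"
proof -
  let ?c = "direction \<sigma> S" and ?r = "total_room k \<sigma> S"
  have poly: "polytope P" using P by (simp add: cube_polytope_def)
  have fin: "finite (?r ` polytope_vertices P)" "?r ` polytope_vertices P \<noteq> {}"
    using finite_polytope_vertices[OF poly] u by auto
  obtain y where y: "y \<in> polytope_vertices P" "Min (?r ` polytope_vertices P) = ?r y"
    using Min_in[OF fin] by blast
  have least: "?r y \<le> ?r v" if "v \<in> polytope_vertices P" for v
    using Min_le[OF fin(1)] that by (simp flip: y(2))
  define F where "F = P \<inter> {x. ?c \<bullet> x = ?c \<bullet> y}"
  have "P = convex hull (polytope_vertices P)"
    unfolding polytope_vertices_def using poly
    by (intro Krein_Milman_Minkowski) (auto simp: polytope_imp_compact polytope_imp_convex)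
  also have "\<dots> \<subseteq> {x. ?c \<bullet> x \<le> ?c \<bullet> y}"
  proof (rule hull_minimal)
    show "polytope_vertices P \<subseteq> {x. ?c \<bullet> x \<le> ?c \<bullet> y}"
      using least y(1) by (auto simp: inner_direction[OF P] simp del: of_int_sum)
  qed (rule convex_halfspace_le)
  finally have F: "F face_of P"
    unfolding F_def using poly
    by (intro face_of_Int_supporting_hyperplane_le) (auto simp: polytope_imp_convex)
  have "polytope_vertices F = {v \<in> polytope_vertices P. ?r v = ?r y}"
    unfolding polytope_vertices_face[OF F] using y(1) polytope_vertices_subset[of P]
    by (auto simp: F_def inner_direction[OF P] simp del: of_int_sum)
  then show ?thesis using that F y(1) least by (auto simp: least_room_face_def)
qed

text \<open>Total rooms are integers, so every improving edge gains at least one.\<close>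
lemma descend_to_face:
  fixes S :: "'n::finite set"
  assumes P: "cube_polytope k I P" and "u \<in> polytope_vertices P" and y: "y \<in> polytope_vertices P"
    and least: "\<And>v. v \<in> polytope_vertices P \<Longrightarrow> total_room k \<sigma> S y \<le> total_room k \<sigma> S v"
  shows "\<exists>w. w \<in> polytope_vertices P \<and> total_room k \<sigma> S w = total_room k \<sigma> S y \<and>
    reaches (polytope_edges P) (nat (total_room k \<sigma> S u - total_room k \<sigma> S y)) u w"
  using assms(2)
proof (induction "nat (total_room k \<sigma> S u - total_room k \<sigma> S y)" arbitrary: u rule: less_induct)
  case less
  let ?r = "total_room k \<sigma> S"
  show ?case
  proof (cases "?r u = ?r y")
    case True
    then show ?thesis using less.prems by (intro exI[of _ u]) (simp add: reaches_refl)
  next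
    case False
    then have "?r y < ?r u" using least[OF less.prems] by simp
    then obtain u' where u': "(u, u') \<in> polytope_edges P" "u' \<in> polytope_vertices P" "?r u' < ?r u"
      using room_decreasing_edge[OF P less.prems y] by blast
    have "nat (?r u' - ?r y) < nat (?r u - ?r y)" using u' least[OF u'(2)] by simp
    from less.hyps[OF this u'(2)] obtain w where w: "w \<in> polytope_vertices P" "?r w = ?r y"
      "reaches (polytope_edges P) (nat (?r u' - ?r y)) u' w" by blast
    have "reaches (polytope_edges P) (Suc (nat (?r u' - ?r y))) u w"
      using reaches_step[OF u'(1) w(3)] .
    then have "reaches (polytope_edges P) (nat (?r u - ?r y)) u w"
      by (rule reaches_mono) (use u' least[OF u'(2)] in auto)
    then show ?thesis using w by blast
  qed
qed

lemma reaches_through_face: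
  fixes S :: "'n::finite set"
  assumes P: "cube_polytope k I P" and u: "u \<in> polytope_vertices P" and v: "v \<in> polytope_vertices P"
    and face: "least_room_face k \<sigma> S P F y"
    and D: "\<And>w z. w \<in> polytope_vertices F \<Longrightarrow> z \<in> polytope_vertices F \<Longrightarrow>
      reaches (polytope_edges F) D w z"
  shows "reaches (polytope_edges P)
    (nat (total_room k \<sigma> S u + total_room k \<sigma> S v - 2 * total_room k \<sigma> S y) + D) u v"
proof -
  let ?r = "total_room k \<sigma> S" and ?E = "polytope_edges P"
  have F: "F face_of P" "y \<in> polytope_vertices F"
    and vF: "polytope_vertices F = {v \<in> polytope_vertices P. ?r v = ?r y}"
    and least: "\<And>v. v \<in> polytope_vertices P \<Longrightarrow> ?r y \<le> ?r v"
    using face unfolding least_room_face_def by blast+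
  have y: "y \<in> polytope_vertices P" using F(2) vF by simp
  obtain w where w: "w \<in> polytope_vertices P" "?r w = ?r y" "reaches ?E (nat (?r u - ?r y)) u w"
    using descend_to_face[OF P u y least] by blast
  obtain z where z: "z \<in> polytope_vertices P" "?r z = ?r y" "reaches ?E (nat (?r v - ?r y)) v z"
    using descend_to_face[OF P v y least] by blast
  have "w \<in> polytope_vertices F" "z \<in> polytope_vertices F" using w z vF by auto
  then have "reaches ?E D w z"
    by (rule reaches_mono[OF D]) (use polytope_edges_face[OF F(1)] in auto)
  moreover have "reaches ?E (nat (?r v - ?r y)) z v"
    using z(3) by (rule reaches_sym[OF sym_polytope_edges])
  ultimately have "reaches ?E (nat (?r u - ?r y) + (D + nat (?r v - ?r y))) u v"
    using w(3) by (blast intro: reaches_trans)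
  then show ?thesis
    by (rule reaches_mono) (use least[OF u] least[OF v] in auto)
qed

section \<open>Walking to a corner of the cube\<close>

text \<open>
  One coordinate of \<open>T\<close> at a time is made constant. For each of them the walks from \<open>u\<close> and \<open>v\<close> to the
  lowest face and those to the highest face have total length twice the width, so
  one of the two choices costs at most \<open>g\<close> steps.
\<close>
lemma reaches_narrow:
  fixes Q :: "(real ^ 'n) set"
  assumes "finite T" and "cube_polytope k I Q"
    and "\<And>\<sigma> i p q. i \<in> T \<Longrightarrow> p \<in> polytope_vertices Q \<Longrightarrow> q \<in> polytope_vertices Q \<Longrightarrow>
      room k \<sigma> p i \<le> room k \<sigma> q i + int g"
    and "\<And>F u v. F face_of Q \<Longrightarrow>
      \<forall>i\<in>T. \<forall>p\<in>polytope_vertices F. \<forall>q\<in>polytope_vertices F. p $ i = q $ i \<Longrightarrow>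
      u \<in> polytope_vertices F \<Longrightarrow> v \<in> polytope_vertices F \<Longrightarrow> reaches (polytope_edges F) B u v"
    and "u \<in> polytope_vertices Q" "v \<in> polytope_vertices Q"
  shows "reaches (polytope_edges Q) (card T * g + B) u v"
  using assms
proof (induction T arbitrary: Q u v rule: finite_induct)
  case empty
  have "Q face_of Q" using empty.prems(1)
    by (simp add: cube_polytope_def face_of_refl polytope_imp_convex)
  then show ?case using empty.prems(3)[of Q u v] empty.prems(4,5) by simp
next
  case (insert i T)
  note Q = insert.prems(1) and narrow = insert.prems(2) and bound = insert.prems(3)
    and uv = insert.prems(4,5)
  have one_side: "reaches (polytope_edges Q) (card (insert i T) * g + B) u v"
    if face: "least_room_face k \<tau> {i} Q F y"
      and le: "room k \<tau> u i + room k \<tau> v i - 2 * room k \<tau> y i \<le> int g" for \<tau> F y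
  proof -
    have y: "F face_of Q" "polytope_vertices F =
        {v \<in> polytope_vertices Q. total_room k \<tau> {i} v = total_room k \<tau> {i} y}"
      using face unfolding least_room_face_def by blast+
    have F: "cube_polytope k I F" using cube_polytope_face[OF Q y(1)] .
    have sub: "polytope_vertices F \<subseteq> polytope_vertices Q" using y(2) by auto
    have const: "p $ i = q $ i" if "p \<in> polytope_vertices F" "q \<in> polytope_vertices F" for p q
    proof -
      have "room k \<tau> p i = room k \<tau> q i" using that y(2) by (auto simp: total_room_def)
      then show ?thesis using room_eq_iff[OF F that] by simp
    qed
    have inF: "reaches (polytope_edges F) (card T * g + B) w z"
      if wz: "w \<in> polytope_vertices F" "z \<in> polytope_vertices F" for w z
    proof (rule insert.IH[OF F _ _ wz])
      show "room k \<sigma> p j \<le> room k \<sigma> q j + int g"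
        if "j \<in> T" "p \<in> polytope_vertices F" "q \<in> polytope_vertices F" for \<sigma> j p q
        using that sub by (intro narrow) auto
      show "reaches (polytope_edges G) B p q"
        if G: "G face_of F"
          "\<forall>i\<in>T. \<forall>p\<in>polytope_vertices G. \<forall>q\<in>polytope_vertices G. p $ i = q $ i"
          "p \<in> polytope_vertices G" "q \<in> polytope_vertices G" for G p q
      proof (rule bound[OF _ _ G(3,4)])
        show "G face_of Q" using face_of_trans[OF G(1) y(1)] .
        have "polytope_vertices G \<subseteq> polytope_vertices F"
          using polytope_vertices_face[OF G(1)] by simp
        then show "\<forall>i\<in>insert i T. \<forall>p\<in>polytope_vertices G. \<forall>q\<in>polytope_vertices G. p $ i = q $ i"
          using G(2) const by blast
      qed
    qed
    show ?thesis
      by (rule reaches_mono[OF reaches_through_face[OF Q uv face inF]])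
        (use le insert.hyps in \<open>auto simp: total_room_def\<close>)
  qed
  let ?s = "\<lambda>_::'n. True" and ?t = "\<lambda>_::'n. False"
  obtain F y where Fy: "least_room_face k ?s {i} Q F y"
    using least_room_face_exists[OF Q uv(1)] by blast
  obtain G z where Gz: "least_room_face k ?t {i} Q G z"
    using least_room_face_exists[OF Q uv(1)] by blast
  have "room k ?s z i \<le> room k ?s y i + int g"
    by (rule narrow) (use Fy Gz in \<open>auto simp: least_room_face_def\<close>)
  then have "room k ?s u i + room k ?s v i - 2 * room k ?s y i \<le> int g \<or>
      room k ?t u i + room k ?t v i - 2 * room k ?t z i \<le> int g"
    by (auto simp: room_def)
  then show ?case using one_side[OF Fy] one_side[OF Gz] by blast
qed

text \<open>
  The face of least total room \<open>\<gamma>\<close> need not lie in the corner. If \<open>\<gamma> > 0\<close>, both walks are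
  shorter by \<open>\<gamma>\<close>, but the \<open>|S|\<close> rooms still vary on the face, each by at most \<open>\<gamma>\<close>;
  making all but one of them constant costs \<open>(|S| - 1) \<gamma>\<close> steps and fixes the last one as
  well. The balance \<open>(|S| - 3) \<gamma>\<close> is no loss up to three coordinates.
\<close>
lemma reaches_via_corner:
  fixes S :: "'n::finite set"
  assumes P: "cube_polytope k I P" and wz: "w \<in> polytope_vertices P" "z \<in> polytope_vertices P"
    and S: "S \<noteq> {}" and bound: "diameter_bound k (I - S) B"
  obtains y where "y \<in> polytope_vertices P" "0 \<le> total_room k \<sigma> S y"
    "0 \<le> total_room k \<sigma> S w + total_room k \<sigma> S z + (int (card S) - 3) * total_room k \<sigma> S y"
    "reaches (polytope_edges P) (nat (total_room k \<sigma> S w + total_room k \<sigma> S z +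
      (int (card S) - 3) * total_room k \<sigma> S y) + B) w z"
proof -
  obtain F y where face: "least_room_face k \<sigma> S P F y"
    using least_room_face_exists[OF P wz(1)] by blast
  then have y: "F face_of P" "y \<in> polytope_vertices F" "polytope_vertices F =
      {v \<in> polytope_vertices P. total_room k \<sigma> S v = total_room k \<sigma> S y}"
    and least: "\<And>v. v \<in> polytope_vertices P \<Longrightarrow> total_room k \<sigma> S y \<le> total_room k \<sigma> S v"
    unfolding least_room_face_def by blast+
  define \<gamma> where "\<gamma> = total_room k \<sigma> S y"
  have yP: "y \<in> polytope_vertices P" using y by auto
  have \<gamma>0: "0 \<le> \<gamma>"
    unfolding \<gamma>_def total_room_def using room_range(1)[OF P yP] by (intro sum_nonneg)
  have F: "cube_polytope k I F" using cube_polytope_face[OF P y(1)] .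
  obtain i0 where i0: "i0 \<in> S" using S by blast
  have small: "0 \<le> room k \<sigma> p i" "room k \<sigma> p i \<le> \<gamma>"
    if "i \<in> S" "p \<in> polytope_vertices F" for i p
  proof -
    show "0 \<le> room k \<sigma> p i" using room_range(1)[OF F that(2)] .
    have "room k \<sigma> p i \<le> total_room k \<sigma> S p"
      unfolding total_room_def using room_range(1)[OF F that(2)] that(1)
      by (intro member_le_sum) auto
    also have "\<dots> = \<gamma>" using that(2) y(3) by (simp add: \<gamma>_def)
    finally show "room k \<sigma> p i \<le> \<gamma>" .
  qed
  have inF: "reaches (polytope_edges F) (card (S - {i0}) * nat \<gamma> + B) p q"
    if pq: "p \<in> polytope_vertices F" "q \<in> polytope_vertices F" for p q
  proof (rule reaches_narrow[OF _ F _ _ pq])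
    show "room k \<tau> a i \<le> room k \<tau> b i + int (nat \<gamma>)"
      if "i \<in> S - {i0}" "a \<in> polytope_vertices F" "b \<in> polytope_vertices F" for \<tau> i a b
      using small[of i a] small[of i b] that \<gamma>0
      by (auto simp: room_def simp del: zero_le_floor split: if_splits)
    show "reaches (polytope_edges G) B a b"
      if G: "G face_of F"
        "\<forall>i\<in>S - {i0}. \<forall>p\<in>polytope_vertices G. \<forall>q\<in>polytope_vertices G. p $ i = q $ i"
        "a \<in> polytope_vertices G" "b \<in> polytope_vertices G" for G a b
    proof -
      have GF: "polytope_vertices G \<subseteq> polytope_vertices F"
        using polytope_vertices_face[OF G(1)] by simp
      have cG: "cube_polytope k I G" using cube_polytope_face[OF F G(1)] .
      have "c $ i = d $ i" if cd: "c \<in> polytope_vertices G" "d \<in> polytope_vertices G"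
          "i \<notin> I - S" for c d i
      proof (cases "i \<in> S - {i0}")
        case True
        then show ?thesis using G(2) cd by blast
      next
        case False
        show ?thesis
        proof (cases "i = i0")
          case True
          have "c \<in> polytope_vertices F" "d \<in> polytope_vertices F" using cd GF by auto
          then have "total_room k \<sigma> S c = total_room k \<sigma> S d" using y(3) by simp
          moreover have "(\<Sum>j\<in>S - {i0}. room k \<sigma> c j) = (\<Sum>j\<in>S - {i0}. room k \<sigma> d j)"
          proof (rule sum.cong)
            fix j assume "j \<in> S - {i0}"
            then have "c $ j = d $ j" using G(2) cd by blast
            then show "room k \<sigma> c j = room k \<sigma> d j" by (simp add: room_eq_iff[OF cG cd(1,2)])
          qed simp
          ultimately have "room k \<sigma> c i0 = room k \<sigma> d i0"
            unfolding total_room_def using i0 by (simp add: sum.remove[of S i0])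
          then show ?thesis using room_eq_iff[OF cG cd(1,2)] True by simp
        next
          case 2: False
          then have "i \<notin> I" using False cd by blast
          then show ?thesis using cG cd unfolding cube_polytope_def by blast
        qed
      qed
      then have "cube_polytope k (I - S) G" using cG unfolding cube_polytope_def by blast
      then show ?thesis using bound G(3,4) unfolding diameter_bound_def by blast
    qed
  qed simp
  have card: "int (card (S - {i0})) = int (card S) - 1"
    using i0 S by (simp add: card_gt_0_iff of_nat_diff Suc_leI)
  define c where "c = card (S - {i0}) * nat \<gamma>"
  have "int c = (int (card S) - 1) * \<gamma>"
    unfolding c_def using \<gamma>0 card by simp
  then have c: "(int (card S) - 3) * \<gamma> = int c - 2 * \<gamma>" by (simp add: algebra_simps)
  have \<gamma>_le: "\<gamma> \<le> total_room k \<sigma> S w" "\<gamma> \<le> total_room k \<sigma> S z"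
    using least wz by (simp_all add: \<gamma>_def)
  have nonneg: "0 \<le> total_room k \<sigma> S w + total_room k \<sigma> S z + (int (card S) - 3) * \<gamma>"
    unfolding c using \<gamma>_le by simp
  have steps: "nat (total_room k \<sigma> S w + total_room k \<sigma> S z - 2 * \<gamma>) + (c + B) =
      nat (total_room k \<sigma> S w + total_room k \<sigma> S z + (int (card S) - 3) * \<gamma>) + B"
    using c \<gamma>_le by simp
  have "reaches (polytope_edges P)
      (nat (total_room k \<sigma> S w + total_room k \<sigma> S z - 2 * \<gamma>) + (c + B)) w z"
    unfolding c_def \<gamma>_def by (rule reaches_through_face[OF P wz face inF[unfolded \<gamma>_def]])
  then have "reaches (polytope_edges P) (nat (total_room k \<sigma> S w + total_room k \<sigma> S z +
      (int (card S) - 3) * \<gamma>) + B) w z"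
    unfolding steps .
  then show ?thesis using that[OF yP] \<gamma>0 nonneg unfolding \<gamma>_def by blast
qed

section \<open>Orientation in coordinate planes\<close>

lemma edge_supporting_hyperplane:
  assumes "polytope P" and "(p, p') \<in> polytope_edges P"
  obtains a where "a \<bullet> p' = a \<bullet> p"
    "\<And>x. x \<in> polytope_vertices P \<Longrightarrow> x \<noteq> p \<Longrightarrow> x \<noteq> p' \<Longrightarrow> a \<bullet> x < a \<bullet> p"
proof -
  let ?s = "closed_segment p p'"
  have face: "?s face_of P"
    using assms(2) by (simp add: polytope_edges_def edge_of_def)
  then have "?s exposed_face_of P"
    using assms(1) by (simp add: exposed_face_of_polyhedron polytope_imp_polyhedron)
  then obtain a b where ab: "P \<subseteq> {x. a \<bullet> x \<le> b}" "?s = P \<inter> {x. a \<bullet> x = b}"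
    unfolding exposed_face_of_def by auto
  have "p \<in> ?s" "p' \<in> ?s" by simp_all
  then have eq: "a \<bullet> p = b" "a \<bullet> p' = b" using ab(2) by blast+
  have less: "a \<bullet> x < a \<bullet> p" if x: "x \<in> polytope_vertices P" "x \<noteq> p" "x \<noteq> p'" for x
  proof (rule ccontr)
    assume "\<not> ?thesis"
    moreover have "x \<in> P" using x(1) polytope_vertices_subset by blast
    ultimately have "x \<in> ?s" using ab eq by (auto simp: not_less)
    then have "x extreme_point_of ?s"
      using x(1) face by (simp add: polytope_vertices_def extreme_point_of_face)
    then show False using x by (simp add: extreme_point_of_segment)
  qed
  show ?thesis by (rule that[OF _ less]) (use eq in auto)
qed

lemma inner_agreeing_outside:
  fixes a p q :: "real ^ 'n"
  assumes "\<And>l. l \<notin> T \<Longrightarrow> q $ l = p $ l"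
  shows "a \<bullet> q - a \<bullet> p = (\<Sum>l\<in>T. a $ l * (q $ l - p $ l))"
proof -
  have "a \<bullet> q - a \<bullet> p = (\<Sum>l\<in>UNIV. a $ l * (q $ l - p $ l))"
    by (simp add: inner_vec_def right_diff_distrib sum_subtractf)
  also have "\<dots> = (\<Sum>l\<in>T. a $ l * (q $ l - p $ l))"
    using assms by (intro sum.mono_neutral_right) auto
  finally show ?thesis .
qed

lemma edge_not_collinear:
  assumes P: "cube_polytope k I P" and e: "(p, p') \<in> polytope_edges P"
    and x: "x \<in> polytope_vertices P"
    and agree: "\<And>l. l \<noteq> i \<Longrightarrow> p' $ l = p $ l" "\<And>l. l \<noteq> i \<Longrightarrow> x $ l = p $ l"
  shows "x = p \<or> x = p'"
proof (rule ccontr)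
  assume no: "\<not> ?thesis"
  have "polytope P" using P by (simp add: cube_polytope_def)
  then obtain a where a: "a \<bullet> p' = a \<bullet> p"
    "\<And>x. x \<in> polytope_vertices P \<Longrightarrow> x \<noteq> p \<Longrightarrow> x \<noteq> p' \<Longrightarrow> a \<bullet> x < a \<bullet> p"
    using edge_supporting_hyperplane e by blast
  have "p \<noteq> p'" using e by (simp add: polytope_edges_def)
  then have "p' $ i \<noteq> p $ i" using agree(1) by (metis vec_eq_iff)
  moreover have "a \<bullet> p' - a \<bullet> p = a $ i * (p' $ i - p $ i)"
    using inner_agreeing_outside[of "{i}" p' p a] agree(1) by simp
  ultimately have "a $ i = 0" using a(1) by simp
  moreover have "a \<bullet> x - a \<bullet> p = a $ i * (x $ i - p $ i)"
    using inner_agreeing_outside[of "{i}" x p a] agree(2) by simp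
  ultimately show False using a(2)[OF x] no by simp
qed

definition axis_coplanar :: "'n::finite \<Rightarrow> 'n \<Rightarrow> real ^ 'n \<Rightarrow> real ^ 'n \<Rightarrow> bool" where
  "axis_coplanar i j p q \<longleftrightarrow> (\<forall>l. l \<noteq> i \<longrightarrow> l \<noteq> j \<longrightarrow> p $ l = q $ l)"

text \<open>
  The orientation of the triangle \<open>p\<close>, \<open>q\<close>, \<open>x\<close> in the plane of \<open>i\<close> and \<open>j\<close>, measured in rooms: a
  different \<open>\<sigma>\<close> can change only its sign, so signs are compared for a fixed \<open>\<sigma>\<close>.
\<close>
definition turn :: "nat \<Rightarrow> ('n::finite \<Rightarrow> bool) \<Rightarrow> 'n \<Rightarrow> 'n \<Rightarrow>
    real ^ 'n \<Rightarrow> real ^ 'n \<Rightarrow> real ^ 'n \<Rightarrow> int" where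
  "turn k \<sigma> i j p q x =
     (room k \<sigma> p i - room k \<sigma> q i) * (room k \<sigma> q j - room k \<sigma> x j) -
     (room k \<sigma> p j - room k \<sigma> q j) * (room k \<sigma> q i - room k \<sigma> x i)"

lemma turn_rotate: "turn k \<sigma> i j q x p = turn k \<sigma> i j p q x"
  by (simp add: turn_def algebra_simps)

text \<open>
  A hyperplane that supports \<open>P\<close> along the edge meets the plane in the line through \<open>p\<close> and \<open>q\<close>, and all
  other vertices lie strictly on one side of it. In the plane the functional of the hyperplane, with
  coefficients \<open>A\<close> and \<open>B\<close>, is a multiple of the orientation. Either coefficient may vanish, which is why
  the proof divides by \<open>A\<^sup>2 + B\<^sup>2\<close> only.
\<close>
lemma same_side_of_edge:
  fixes i j :: "'n::finite"
  assumes P: "cube_polytope k I P" and e: "(p, q) \<in> polytope_edges P" and ij: "i \<noteq> j"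
    and x: "x \<in> polytope_vertices P" "x \<noteq> p" "x \<noteq> q"
    and y: "y \<in> polytope_vertices P" "y \<noteq> p" "y \<noteq> q"
    and plane: "axis_coplanar i j p q" "axis_coplanar i j p x" "axis_coplanar i j p y"
  shows "0 < turn k \<sigma> i j p q x * turn k \<sigma> i j p q y"
proof -
  have "polytope P" using P by (simp add: cube_polytope_def)
  then obtain a where a: "a \<bullet> q = a \<bullet> p"
    "\<And>x. x \<in> polytope_vertices P \<Longrightarrow> x \<noteq> p \<Longrightarrow> x \<noteq> q \<Longrightarrow> a \<bullet> x < a \<bullet> p"
    using edge_supporting_hyperplane e by blast
  have pq: "p \<in> polytope_vertices P" "q \<in> polytope_vertices P" "p \<noteq> q"
    using e by (auto simp: polytope_edges_def)
  let ?r = "\<lambda>z l. real_of_int (room k \<sigma> z l)"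
  define A where "A = (if \<sigma> i then a $ i else - a $ i)"
  define B where "B = (if \<sigma> j then a $ j else - a $ j)"
  have inner: "a \<bullet> z - a \<bullet> p = A * (?r p i - ?r z i) + B * (?r p j - ?r z j)"
    if z: "z \<in> polytope_vertices P" "axis_coplanar i j p z" for z
  proof -
    have "a \<bullet> z - a \<bullet> p = a $ i * (z $ i - p $ i) + a $ j * (z $ j - p $ j)"
      using inner_agreeing_outside[of "{i, j}" z p a] z(2) ij by (simp add: axis_coplanar_def)
    also have "\<dots> = A * (?r p i - ?r z i) + B * (?r p j - ?r z j)"
      unfolding room_eq[OF P z(1)] room_eq[OF P pq(1)] A_def B_def by (simp add: algebra_simps)
    finally show ?thesis .
  qed
  define g h where "g = ?r p i - ?r q i" and "h = ?r p j - ?r q j"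
  have "g \<noteq> 0 \<or> h \<noteq> 0"
  proof (rule ccontr)
    assume "\<not> ?thesis"
    then have "p $ i = q $ i" "p $ j = q $ j"
      by (simp_all add: g_def h_def room_eq_iff[OF P pq(1,2)])
    then have "p = q" using plane(1) by (metis axis_coplanar_def vec_eq_iff)
    then show False using pq(3) by simp
  qed
  then have gh: "0 < g\<^sup>2 + h\<^sup>2" by (simp add: sum_power2_gt_zero_iff)
  have AB: "A * g + B * h = 0" using inner[OF pq(2) plane(1)] a(1) by (simp add: g_def h_def)
  have side: "A * t = - h * X \<and> B * t = g * X \<and> X < 0"
    if "z \<in> polytope_vertices P" "z \<noteq> p" "z \<noteq> q" "axis_coplanar i j p z"
      "X = a \<bullet> z - a \<bullet> p" "t = of_int (turn k \<sigma> i j p q z)" for z X t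
  proof -
    have X: "X = A * (?r p i - ?r z i) + B * (?r p j - ?r z j)"
      using inner that by simp
    have t: "t = g * (?r p j - ?r z j) - h * (?r p i - ?r z i)"
      unfolding that(6) turn_def g_def h_def by (simp add: algebra_simps)
    have Ag: "A * g = - B * h" using AB by simp
    have "A * t = (A * g) * (?r p j - ?r z j) - h * A * (?r p i - ?r z i)"
      unfolding t by (simp add: algebra_simps)
    also have "\<dots> = - h * X" unfolding Ag X by (simp add: algebra_simps)
    finally have 1: "A * t = - h * X" .
    have "B * t = g * B * (?r p j - ?r z j) - (B * h) * (?r p i - ?r z i)"
      unfolding t by (simp add: algebra_simps)
    also have "B * h = - (A * g)" using AB by simp
    finally have "B * t = g * X" unfolding X by (simp add: algebra_simps)
    then show ?thesis using 1 a(2) that by simp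
  qed
  define X Y where "X = a \<bullet> x - a \<bullet> p" and "Y = a \<bullet> y - a \<bullet> p"
  define s t where "s = real_of_int (turn k \<sigma> i j p q x)" and "t = real_of_int (turn k \<sigma> i j p q y)"
  note sx = side[OF x plane(2) X_def s_def] and sy = side[OF y plane(3) Y_def t_def]
  have "(A\<^sup>2 + B\<^sup>2) * (s * t) = (A * s) * (A * t) + (B * s) * (B * t)"
    by (simp add: algebra_simps power2_eq_square)
  also have "\<dots> = (g\<^sup>2 + h\<^sup>2) * (X * Y)"
    using sx sy by (simp add: algebra_simps power2_eq_square)
  also have "\<dots> > 0" using gh sx sy by (intro mult_pos_pos mult_neg_neg) auto
  finally have "0 < s * t"
    by (metis add_nonneg_nonneg mult_less_cancel_left_pos mult_zero_left mult_zero_right order_le_less zero_le_power2)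
  then have "0 < real_of_int (turn k \<sigma> i j p q x * turn k \<sigma> i j p q y)"
    by (simp add: s_def t_def)
  then show ?thesis by (simp only: of_int_0_less_iff)
qed

lemma axis_coplanar_sym: "axis_coplanar i j p q \<Longrightarrow> axis_coplanar i j q p"
  and axis_coplanar_trans: "axis_coplanar i j p q \<Longrightarrow> axis_coplanar i j q x \<Longrightarrow> axis_coplanar i j p x"
  by (auto simp: axis_coplanar_def)

lemma turn_nonzero:
  fixes i j :: "'n::finite"
  assumes P: "cube_polytope k I P" and e: "(p, q) \<in> polytope_edges P" and ij: "i \<noteq> j"
    and x: "x \<in> polytope_vertices P" "x \<noteq> p" "x \<noteq> q"
    and plane: "axis_coplanar i j p q" "axis_coplanar i j p x"
  shows "turn k \<sigma> i j p q x \<noteq> 0"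
  using same_side_of_edge[OF P e ij x x plane(1) plane(2) plane(2), of \<sigma>] by auto

text \<open>
  Three consecutive edges in a plane turn in the same sense. If their steps are \<open>(\<alpha>, 1 - \<alpha>)\<close>, a turn is
  the difference of two consecutive \<open>\<alpha>\<close>, so the numbers \<open>\<alpha>\<close> are strictly monotone along the walk.
\<close>
lemma turns_agree:
  fixes i j :: "'n::finite"
  assumes P: "cube_polytope k I P" and e: "(p, q) \<in> polytope_edges P" "(q, x) \<in> polytope_edges P"
      "(x, y) \<in> polytope_edges P"
    and ne: "i \<noteq> j" "p \<noteq> x" "q \<noteq> y"
    and plane: "axis_coplanar i j p q" "axis_coplanar i j q x" "axis_coplanar i j x y"
  shows "0 < turn k \<sigma> i j p q x * turn k \<sigma> i j q x y"
proof -
  have "p \<noteq> q" "x \<noteq> y" "p \<in> polytope_vertices P" "y \<in> polytope_vertices P"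
    using e by (auto simp: polytope_edges_def)
  then have "0 < turn k \<sigma> i j q x p * turn k \<sigma> i j q x y"
    using ne plane by (intro same_side_of_edge[OF P e(2)]) (auto intro: axis_coplanar_sym axis_coplanar_trans)
  then show ?thesis by (simp add: turn_rotate)
qed

section \<open>Pairs of distant vertices\<close>

lemma relpow_edges_vertex:
  "(u, w) \<in> polytope_edges P ^^ n \<Longrightarrow> u \<in> polytope_vertices P \<Longrightarrow> w \<in> polytope_vertices P"
proof (cases n)
  case (Suc m)
  assume "(u, w) \<in> polytope_edges P ^^ n"
  then obtain y where "(y, w) \<in> polytope_edges P" using Suc by auto
  then show ?thesis by (simp add: polytope_edges_def)
qed simp

lemma room_flip: "room k \<sigma>' p i = int k - room k \<sigma> p i" if "\<sigma>' i \<noteq> \<sigma> i"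
  using that by (auto simp: room_def)

lemma room_cong: "room k \<sigma>' p i = room k \<sigma> p i" if "\<sigma>' i = \<sigma> i"
  using that by (auto simp: room_def)

text \<open>
  What a distance above \<open>\<delta>(d - 1) + k - 1\<close> entails: no step, made from \<open>u\<close> or from \<open>v\<close>, gains on a
  single coordinate, and every side of the cube touches \<open>P\<close>.
\<close>
locale distant_vertices =
  fixes k :: nat and I :: "'n::finite set" and P :: "(real ^ 'n) set" and u v :: "real ^ 'n"
  assumes cube: "cube_polytope k I P"
    and u: "u \<in> polytope_vertices P" and v: "v \<in> polytope_vertices P"
    and single: "\<And>\<sigma> i a b w z. i \<in> I \<Longrightarrow>
      (u, w) \<in> polytope_edges P ^^ a \<Longrightarrow> (v, z) \<in> polytope_edges P ^^ b \<Longrightarrow>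
      int k - int (a + b) \<le> room k \<sigma> w i + room k \<sigma> z i"
    and side: "\<And>\<sigma> i. i \<in> I \<Longrightarrow> \<exists>y\<in>polytope_vertices P. room k \<sigma> y i = 0"
begin

abbreviation "E \<equiv> polytope_edges P"

lemma swapped: "distant_vertices k I P v u"
proof
  show "int k - int (a + b) \<le> room k \<sigma> w i + room k \<sigma> z i"
    if "i \<in> I" "(v, w) \<in> E ^^ a" "(u, z) \<in> E ^^ b" for \<sigma> i a b w z
    using single[OF that(1,3,2), of \<sigma>] by (simp add: add.commute)
qed (use cube u v side in auto)

text \<open>The bound for no steps at all, applied to both opposite sides.\<close>
lemma opposite:
  assumes "i \<in> I"
  shows "room k \<sigma> u i + room k \<sigma> v i = int k"
proof -
  let ?\<tau> = "\<lambda>l. \<not> \<sigma> l"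
  have "int k \<le> room k \<sigma> u i + room k \<sigma> v i" using single[OF assms, of u 0 v 0 \<sigma>] by simp
  moreover have "int k \<le> room k ?\<tau> u i + room k ?\<tau> v i" using single[OF assms, of u 0 v 0 ?\<tau>] by simp
  ultimately show ?thesis by (simp add: room_flip[of ?\<tau> _ \<sigma>])
qed

lemma edge_vertices:
  assumes "(p, q) \<in> E"
  shows "p \<in> polytope_vertices P" "q \<in> polytope_vertices P" "p \<noteq> q"
  using assms by (auto simp: polytope_edges_def)

lemma step_towards:
  assumes "p \<in> polytope_vertices P" "y \<in> polytope_vertices P" "room k \<sigma> y i < room k \<sigma> p i"
  obtains q where "(p, q) \<in> E" "room k \<sigma> q i < room k \<sigma> p i"
proof -
  have "total_room k \<sigma> {i} y < total_room k \<sigma> {i} p" using assms(3) by (simp add: total_room_def)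
  then obtain q where "(p, q) \<in> E" "total_room k \<sigma> {i} q < total_room k \<sigma> {i} p"
    using room_decreasing_edge[OF cube assms(1,2)] by blast
  then show ?thesis using that by (simp add: total_room_def)
qed

lemma next_step:
  assumes "i \<in> I" "(u, p) \<in> E ^^ n" "room k \<sigma> p i = room k \<sigma> u i - int n" "0 < room k \<sigma> p i"
  obtains q where "(p, q) \<in> E" "(u, q) \<in> E ^^ Suc n" "room k \<sigma> q i = room k \<sigma> u i - int (Suc n)"
proof -
  obtain y where "y \<in> polytope_vertices P" "room k \<sigma> y i = 0" using side[OF assms(1)] by blast
  then obtain q where q: "(p, q) \<in> E" "room k \<sigma> q i < room k \<sigma> p i"
    using step_towards[OF relpow_edges_vertex[OF assms(2) u]] assms(4) by metis
  have uq: "(u, q) \<in> E ^^ Suc n" using assms(2) q(1) by auto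
  have "int k - int (Suc n) \<le> room k \<sigma> q i + room k \<sigma> v i"
    using single[OF assms(1) uq, of v 0 \<sigma>] by simp
  then have "room k \<sigma> q i = room k \<sigma> u i - int (Suc n)"
    using q(2) opposite[OF assms(1), of \<sigma>] assms(3) by simp
  then show ?thesis using that q(1) uq by blast
qed

lemma first_step:
  assumes "i \<in> I" "0 < room k \<sigma> u i"
  obtains p where "(u, p) \<in> E" "room k \<sigma> p i = room k \<sigma> u i - 1"
  using next_step[OF assms(1), of u 0 \<sigma>] assms(2) by auto

definition axis_parallel_edges :: bool where
  "axis_parallel_edges \<longleftrightarrow>
     (\<forall>w i j. (u, w) \<in> E \<longrightarrow> i \<in> I \<longrightarrow> j \<in> I \<longrightarrow> i \<noteq> j \<longrightarrow> w $ i = u $ i \<or> w $ j = u $ j)"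

lemma agree_outside_if_axis_parallel:
  assumes axis_parallel_edges "(u, w) \<in> E" "i \<in> I" "w $ i \<noteq> u $ i" "l \<noteq> i"
  shows "w $ l = u $ l"
proof (cases "l \<in> I")
  case True
  then show ?thesis using assms unfolding axis_parallel_edges_def by blast
next
  case False
  then show ?thesis using cube u edge_vertices(2)[OF assms(2)] unfolding cube_polytope_def by blast
qed

text \<open>Selects the opposite side in each coordinate when \<open>u\<close> is a corner of the cube.\<close>
definition inward :: "'n \<Rightarrow> bool" where
  "inward l \<longleftrightarrow> u $ l = 0"

text \<open>
  Otherwise there would be edges from \<open>u\<close> in both directions of the axis \<open>i\<close>, and \<open>u\<close> would lie between
  their ends.
\<close>
lemma corner_if_axis_parallel:
  assumes ax: axis_parallel_edges and i: "i \<in> I"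
  shows "room k inward u i = int k"
proof (rule ccontr)
  assume no: "\<not> ?thesis"
  let ?t = "\<lambda>_::'n. True" and ?f = "\<lambda>_::'n. False"
  have r: "0 \<le> room k \<sigma> u i" "room k \<sigma> u i \<le> int k" for \<sigma> using room_range[OF cube u] .
  have flip: "room k ?t x i = int k - room k ?f x i" for x by (rule room_flip) simp
  have real: "u $ i = of_int (room k ?f u i)" using room_eq[OF cube u, of ?f i] by simp
  have "0 < room k ?t u i \<and> 0 < room k ?f u i"
  proof (rule ccontr)
    assume "\<not> ?thesis"
    then have "room k ?f u i = 0 \<or> room k ?f u i = int k" using r[of ?t] r[of ?f] flip by auto
    then show False
    proof
      assume 0: "room k ?f u i = 0"
      then have "room k inward u i = room k ?t u i"
        using real by (intro room_cong) (simp add: inward_def)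
      then show False using no 0 flip by simp
    next
      assume 1: "room k ?f u i = int k"
      show False
      proof (cases "k = 0")
        case True
        then show False using no r[of inward] by simp
      next
        case False
        then have "room k inward u i = room k ?f u i"
          using real 1 by (intro room_cong) (simp add: inward_def)
        then show False using no 1 by simp
      qed
    qed
  qed
  then obtain p q where p: "(u, p) \<in> E" "room k ?t p i = room k ?t u i - 1"
    and q: "(u, q) \<in> E" "room k ?f q i = room k ?f u i - 1"
    using first_step[OF i] by metis
  have pi: "p $ i \<noteq> u $ i" and qi: "q $ i \<noteq> u $ i" and pq: "p $ i \<noteq> q $ i"
    using p q room_eq_iff[OF cube edge_vertices(2)[OF p(1)] u, of ?t i]
      room_eq_iff[OF cube edge_vertices(2)[OF q(1)] u, of ?f i]
      room_eq_iff[OF cube edge_vertices(2)[OF p(1)] edge_vertices(2)[OF q(1)], of ?f i]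
      flip[of p] flip[of u] by auto
  have "q = u \<or> q = p"
    using agree_outside_if_axis_parallel[OF ax p(1) i pi] agree_outside_if_axis_parallel[OF ax q(1) i qi]
    by (intro edge_not_collinear[OF cube p(1) edge_vertices(2)[OF q(1)]])
  then show False using qi pq by auto
qed

text \<open>
  Two steps towards the side at \<open>i\<close> lower the room there by two; the second one cannot
  continue the first in a straight line, so it leaves the corner in another coordinate \<open>j\<close> too.
\<close>
lemma two_steps_if_axis_parallel:
  assumes ax: axis_parallel_edges and i: "i \<in> I" and k: "2 \<le> k"
  obtains p q j where "(u, p) \<in> E" "(p, q) \<in> E" "\<And>l. l \<noteq> i \<Longrightarrow> p $ l = u $ l"
    "room k inward p i = int k - 1" "room k inward q i = int k - 2"
    "j \<in> I" "j \<noteq> i" "room k inward q j < int k"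
proof -
  have ui: "room k inward u i = int k" using corner_if_axis_parallel[OF ax i] .
  obtain p where p: "(u, p) \<in> E" "(u, p) \<in> E ^^ Suc 0" "room k inward p i = int k - 1"
    using next_step[OF i, of u 0 inward] ui k by auto
  obtain q where q: "(p, q) \<in> E" "(u, q) \<in> E ^^ Suc (Suc 0)" "room k inward q i = int k - 2"
    using next_step[OF i p(2), of inward] p(3) ui k by auto
  have "p $ i \<noteq> u $ i"
    using room_eq_iff[OF cube edge_vertices(2)[OF p(1)] u, of inward i] p(3) ui by auto
  then have agree: "\<And>l. l \<noteq> i \<Longrightarrow> p $ l = u $ l"
    using agree_outside_if_axis_parallel[OF ax p(1) i] by blast
  have qV: "q \<in> polytope_vertices P" using edge_vertices(2)[OF q(1)] .
  have "q \<noteq> u" "q \<noteq> p" using q(3) p(3) ui by auto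
  then obtain j where j: "j \<noteq> i" "q $ j \<noteq> u $ j"
    using edge_not_collinear[OF cube p(1) qV agree] by blast
  have jI: "j \<in> I" using j(2) cube u qV unfolding cube_polytope_def by blast
  have "room k inward q j \<noteq> int k"
    using j(2) room_eq_iff[OF cube qV u, of inward j] corner_if_axis_parallel[OF ax jI] by simp
  then have "room k inward q j < int k" using room_range(2)[OF cube qV, of inward j] by simp
  then show ?thesis using that p(1,3) q(1,3) agree j jI by blast
qed

text \<open>
  If no step at all can be saved on two coordinates, an edge at \<open>u\<close> cannot
  change two coordinates, and the two steps of \<open>two_steps_if_axis_parallel\<close> already save one.
\<close>
lemma pairs_not_tight:
  assumes pair: "\<And>\<sigma> i j a b w z. i \<in> I \<Longrightarrow> j \<in> I \<Longrightarrow> i \<noteq> j \<Longrightarrow>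
      (u, w) \<in> E ^^ a \<Longrightarrow> (v, z) \<in> E ^^ b \<Longrightarrow>
      2 * int k - int (a + b) \<le> room k \<sigma> w i + room k \<sigma> w j + room k \<sigma> z i + room k \<sigma> z j"
    and i: "i \<in> I" and k: "2 \<le> k"
  shows False
proof -
  have ax: axis_parallel_edges
    unfolding axis_parallel_edges_def
  proof (intro allI impI, rule ccontr)
    fix w i j assume w: "(u, w) \<in> E" and ij: "i \<in> I" "j \<in> I" "i \<noteq> j"
      and "\<not> (w $ i = u $ i \<or> w $ j = u $ j)"
    then have ne: "w $ i \<noteq> u $ i" "w $ j \<noteq> u $ j" by auto
    define \<sigma> where "\<sigma> = (\<lambda>l. u $ l < w $ l)"
    have wV: "w \<in> polytope_vertices P" using edge_vertices(2)[OF w] .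
    have less: "room k \<sigma> w l < room k \<sigma> u l" if "w $ l \<noteq> u $ l" for l
      unfolding \<sigma>_def using room_decreases_towards[OF cube u wV that] .
    have "2 * int k - 1 \<le> room k \<sigma> w i + room k \<sigma> w j + room k \<sigma> v i + room k \<sigma> v j"
      using pair[OF ij, of w 1 v 0 \<sigma>] w by simp
    then show False
      using less[OF ne(1)] less[OF ne(2)] opposite[OF ij(1), of \<sigma>] opposite[OF ij(2), of \<sigma>] by simp
  qed
  obtain p q j where pq: "(u, p) \<in> E" "(p, q) \<in> E"
    "room k inward q i = int k - 2" "j \<in> I" "j \<noteq> i" "room k inward q j < int k"
    using two_steps_if_axis_parallel[OF ax i k] by metis
  have "(u, q) \<in> E ^^ 2" using pq(1,2) by (auto simp: numeral_2_eq_2)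
  then have "2 * int k - 2 \<le> room k inward q i + room k inward q j + room k inward v i + room k inward v j"
    using pair[OF i pq(4) pq(5)[symmetric], of q 2 v 0 inward] by simp
  moreover have "room k inward v i = 0" "room k inward v j = 0"
    using opposite[OF i, of inward] opposite[OF pq(4), of inward]
      corner_if_axis_parallel[OF ax i] corner_if_axis_parallel[OF ax pq(4)] by simp_all
  ultimately show False using pq by simp
qed

end

section \<open>Polygons\<close>

lemma (in distant_vertices) vertices_agree_outside:
  "p \<in> polytope_vertices P \<Longrightarrow> q \<in> polytope_vertices P \<Longrightarrow> l \<notin> I \<Longrightarrow> p $ l = q $ l"
  using cube unfolding cube_polytope_def by blast

lemma (in distant_vertices) no_three_coplanar_edges:
  assumes e: "(u, x) \<in> E" "(u, y) \<in> E" "(u, z) \<in> E" and ne: "i \<noteq> j" "x \<noteq> y" "x \<noteq> z" "y \<noteq> z"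
    and plane: "axis_coplanar i j u x" "axis_coplanar i j u y" "axis_coplanar i j u z"
  shows False
proof -
  let ?\<sigma> = "\<lambda>_. True"
  note V = edge_vertices(2)[OF e(1)] edge_vertices(2)[OF e(2)] edge_vertices(2)[OF e(3)]
  note n = edge_vertices(3)[OF e(1)] edge_vertices(3)[OF e(2)] edge_vertices(3)[OF e(3)]
  have 1: "0 < turn k ?\<sigma> i j u x y * turn k ?\<sigma> i j u x z"
    using V n ne plane by (intro same_side_of_edge[OF cube e(1)]) auto
  have 2: "0 < turn k ?\<sigma> i j u y x * turn k ?\<sigma> i j u y z"
    using V n ne plane by (intro same_side_of_edge[OF cube e(2)]) auto
  have 3: "0 < turn k ?\<sigma> i j u z x * turn k ?\<sigma> i j u z y"
    using V n ne plane by (intro same_side_of_edge[OF cube e(3)]) auto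
  have "turn k ?\<sigma> i j u y x = - turn k ?\<sigma> i j u x y" "turn k ?\<sigma> i j u z x = - turn k ?\<sigma> i j u x z"
    "turn k ?\<sigma> i j u z y = - turn k ?\<sigma> i j u y z"
    by (simp_all add: turn_def algebra_simps)
  then show False using 1 2 3 by (auto simp: zero_less_mult_iff mult_less_0_iff)
qed

text \<open>
  Four steps across the polygon from \<open>u\<close>, each advancing by one in coordinate \<open>i\<close>, have slopes
  \<open>b1 < b2 < b3 < b4\<close> in coordinate \<open>j\<close> after a reflection. As \<open>b1 \<ge> - 1\<close>, the fourth edge is so steep
  that the line through it passes beyond \<open>v\<close>, which sits at \<open>i\<close> on the opposite side and at \<open>j\<close> in the
  reflected position of \<open>u\<close>.
\<close>
lemma (in distant_vertices) vertex_not_on_side: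
  assumes I: "I = {i, j}" and ij: "i \<noteq> j" and k: "4 \<le> k"
    and far: "\<not> reaches E k u v" and corner: "room k \<sigma> u i = int k"
  shows False
proof -
  have iI: "i \<in> I" and jI: "j \<in> I" using I by auto
  obtain p1 where p1: "(u, p1) \<in> E" "(u, p1) \<in> E ^^ Suc 0" "room k \<sigma> p1 i = int k - 1"
    using next_step[OF iI, of u 0 \<sigma>] corner k by auto
  obtain p2 where p2: "(p1, p2) \<in> E" "(u, p2) \<in> E ^^ Suc (Suc 0)" "room k \<sigma> p2 i = int k - 2"
    using next_step[OF iI p1(2), of \<sigma>] p1(3) corner k by auto
  obtain p3 where p3: "(p2, p3) \<in> E" "(u, p3) \<in> E ^^ Suc (Suc (Suc 0))" "room k \<sigma> p3 i = int k - 3"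
    using next_step[OF iI p2(2), of \<sigma>] p2(3) corner k by auto
  have "room k \<sigma> p3 i = room k \<sigma> u i - int (Suc (Suc (Suc 0)))" "0 < room k \<sigma> p3 i"
    using p3(3) corner k by simp_all
  from next_step[OF iI p3(2) this] obtain p4 where p4': "(p3, p4) \<in> E"
      "(u, p4) \<in> E ^^ Suc (Suc (Suc (Suc 0)))"
      "room k \<sigma> p4 i = room k \<sigma> u i - int (Suc (Suc (Suc (Suc 0))))"
    by blast
  then have p4: "(p3, p4) \<in> E" "(u, p4) \<in> E ^^ 4" "room k \<sigma> p4 i = int k - 4"
    using corner by (simp_all add: numeral_eq_Suc del: relpow.simps)
  note V = u edge_vertices(2)[OF p1(1)] edge_vertices(2)[OF p2(1)] edge_vertices(2)[OF p3(1)]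
    edge_vertices(2)[OF p4(1)] v
  have plane: "axis_coplanar i j p q" if "p \<in> polytope_vertices P" "q \<in> polytope_vertices P" for p q
    using vertices_agree_outside[OF that] I by (auto simp: axis_coplanar_def)
  have vi: "room k \<sigma> v i = 0" using opposite[OF iI, of \<sigma>] corner by simp
  have "p4 \<noteq> v"
  proof
    assume "p4 = v"
    then have "reaches E k u v" using p4(2) k unfolding reaches_def by blast
    then show False using far by simp
  qed
  have impossible: False
    if \<tau>: "\<tau> i = \<sigma> i" and convex: "room k \<tau> u j - room k \<tau> p1 j < room k \<tau> p1 j - room k \<tau> p2 j" for \<tau>
  proof -
    let ?r = "\<lambda>p. room k \<tau> p j"
    define b1 b2 b3 b4 where b: "b1 = ?r u - ?r p1" "b2 = ?r p1 - ?r p2" "b3 = ?r p2 - ?r p3"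
      "b4 = ?r p3 - ?r p4"
    have i: "room k \<tau> x i = room k \<sigma> x i" for x using \<tau> by (rule room_cong)
    have ne: "u \<noteq> p2" "p1 \<noteq> p3" "p2 \<noteq> p4" "v \<noteq> p3" "p2 \<noteq> p3"
      using corner p1(3) p2(3) p3(3) p4(3) vi k by auto
    have t1: "turn k \<tau> i j u p1 p2 = b2 - b1" and t2: "turn k \<tau> i j p1 p2 p3 = b3 - b2"
      and t3: "turn k \<tau> i j p2 p3 p4 = b4 - b3"
      by (simp_all add: turn_def i corner p1(3) p2(3) p3(3) p4(3) b)
    have "0 < (b2 - b1) * (b3 - b2)"
      using turns_agree[OF cube p1(1) p2(1) p3(1) ij ne(1,2), of \<tau>] plane V t1 t2 by simp
    then have b23: "b2 < b3" using convex by (auto simp: b zero_less_mult_iff)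
    have "0 < (b3 - b2) * (b4 - b3)"
      using turns_agree[OF cube p2(1) p3(1) p4(1) ij ne(2,3), of \<tau>] plane V t2 t3 by simp
    then have b34: "b3 < b4" using b23 by (auto simp: zero_less_mult_iff)
    have "0 < turn k \<tau> i j p3 p4 p2 * turn k \<tau> i j p3 p4 v"
      using V plane ne \<open>p4 \<noteq> v\<close> by (intro same_side_of_edge[OF cube p4(1) ij]) auto
    moreover have "turn k \<tau> i j p3 p4 p2 = b4 - b3" using t3 by (simp add: turn_rotate)
    moreover have "turn k \<tau> i j p3 p4 v = (?r p4 - ?r v) - b4 * (int k - 4)"
      by (simp add: turn_def i p3(3) p4(3) vi b)
    ultimately have above: "0 < (?r p4 - ?r v) - b4 * (int k - 4)"
      using b34 by (auto simp: zero_less_mult_iff)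
    have "?r u + ?r v = int k" using opposite[OF jI, of \<tau>] .
    then have above: "b4 * (int k - 4) < 2 * ?r u - int k - (b1 + b2 + b3 + b4)"
      using above by (simp add: b)
    have b1: "-1 \<le> b1"
    proof -
      let ?\<rho> = "\<lambda>l. \<not> \<tau> l"
      have "int k - 1 \<le> room k ?\<rho> p1 j + room k ?\<rho> v j"
        using single[OF jI p1(2), of v 0 ?\<rho>] by simp
      then show ?thesis using opposite[OF jI, of \<tau>] by (simp add: room_flip[of ?\<rho> _ \<tau>] b)
    qed
    have range: "?r u \<le> int k" "?r u - b1 \<le> int k"
      using room_range(2)[OF cube V(1)] room_range(2)[OF cube V(2)] by (auto simp: b)
    have b12: "b1 < b2" using convex by (simp add: b)
    have "2 * (int k - 4) \<le> b4 * (int k - 4)"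
      using b1 b12 b23 b34 k by (intro mult_right_mono) auto
    moreover have "4 \<le> int k" using k by simp
    moreover have "4 * b1 + 6 \<le> b1 + b2 + b3 + b4" using b12 b23 b34 by presburger
    ultimately show False using above range b1 by presburger
  qed
  \<comment> \<open>The choice of the side at \<open>j\<close> is still free; it makes the walk turn in the sense assumed above.\<close>
  let ?\<tau> = "\<lambda>l. if l = i then \<sigma> i else True" and ?\<rho> = "\<lambda>l. if l = i then \<sigma> i else False"
  have "turn k \<sigma> i j u p1 p2 \<noteq> 0"
    using V plane corner p2(3) p1(3) k by (intro turn_nonzero[OF cube p1(1) ij]) auto
  then have "room k \<sigma> u j - room k \<sigma> p1 j \<noteq> room k \<sigma> p1 j - room k \<sigma> p2 j"
    by (simp add: turn_def corner p1(3) p2(3))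
  then have "room k ?\<tau> u j - room k ?\<tau> p1 j < room k ?\<tau> p1 j - room k ?\<tau> p2 j \<or>
      room k ?\<rho> u j - room k ?\<rho> p1 j < room k ?\<rho> p1 j - room k ?\<rho> p2 j"
    using ij by (auto simp: room_def split: if_splits)
  then show False using impossible[of ?\<tau>] impossible[of ?\<rho>] by auto
qed

text \<open>
  Suppose that \<open>v\<close> is more than \<open>k\<close> steps away. Then \<open>u\<close> lies in the interior of the square, so it
  has edges that increase and edges that decrease either coordinate, each by one. There are only two
  edges at \<open>u\<close>, so they would have to point in opposite directions.
\<close>
lemma (in distant_vertices) reaches_in_polygon:
  assumes I: "I = {i, j}" and ij: "i \<noteq> j" and k: "4 \<le> k"
  shows "reaches E k u v"
proof (rule ccontr)
  assume far: "\<not> ?thesis"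
  have iI: "i \<in> I" and jI: "j \<in> I" using I by auto
  let ?t = "\<lambda>_::'n. True" and ?f = "\<lambda>_::'n. False"
  have I': "I = {j, i}" using I by auto
  have flip: "room k ?f p l = int k - room k ?t p l" for p l by (rule room_flip) simp
  have r: "0 \<le> room k \<sigma> u l" "room k \<sigma> u l \<le> int k" for \<sigma> l using room_range[OF cube u] .
  have inner: "0 < room k \<sigma> u l" if "l \<in> I" "\<sigma> = ?t \<or> \<sigma> = ?f" for \<sigma> l
  proof (rule ccontr)
    assume "\<not> ?thesis"
    then have "room k ?t u l = int k \<or> room k ?f u l = int k"
      using r[of \<sigma> l] that(2) flip[of u l] by auto
    then show False
      using that(1) I vertex_not_on_side[OF I ij k far] vertex_not_on_side[OF I' ij[symmetric] k far]
      by auto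
  qed
  have plane: "axis_coplanar i j u q" if "(u, q) \<in> E" for q
    using vertices_agree_outside[OF u edge_vertices(2)[OF that]] I by (auto simp: axis_coplanar_def)
  have pos: "0 < room k ?t u i" "0 < room k ?f u i" "0 < room k ?t u j" "0 < room k ?f u j"
    using inner iI jI by auto
  obtain A where A: "(u, A) \<in> E" "room k ?t A i = room k ?t u i - 1"
    using first_step[OF iI pos(1)] by blast
  obtain B where B: "(u, B) \<in> E" "room k ?f B i = room k ?f u i - 1"
    using first_step[OF iI pos(2)] by blast
  obtain C where C: "(u, C) \<in> E" "room k ?t C j = room k ?t u j - 1"
    using first_step[OF jI pos(3)] by blast
  obtain D where D: "(u, D) \<in> E" "room k ?f D j = room k ?f u j - 1"
    using first_step[OF jI pos(4)] by blast
  have AB: "A \<noteq> B" and CD: "C \<noteq> D" using A B C D flip by auto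
  have "C = A \<or> C = B"
    using no_three_coplanar_edges[OF A(1) B(1) C(1) ij] AB plane A B C by auto
  moreover have "D = A \<or> D = B"
    using no_three_coplanar_edges[OF A(1) B(1) D(1) ij] AB plane A B D by auto
  ultimately have "C = A \<and> D = B \<or> C = B \<and> D = A" using CD by auto
  moreover have "turn k ?t i j u A B \<noteq> 0"
    using plane edge_vertices[OF A(1)] edge_vertices[OF B(1)] AB A(1) B(1)
    by (intro turn_nonzero[OF cube A(1) ij]) auto
  moreover have "room k ?t B i = room k ?t u i + 1" "room k ?t D j = room k ?t u j + 1"
    using B(2) D(2) unfolding flip by simp_all
  ultimately show False using A(2) C(2) by (elim disjE conjE) (simp_all add: turn_def)
qed

section \<open>Savings on two and three coordinates\<close>

text \<open>
  What a distance above \<open>\<delta>(d - 2) + 2k - 2\<close> and \<open>\<delta>(d - 3) + 3k - 2\<close> entails in addition: at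
  most one step can be saved on two or three coordinates, and if one is saved on two coordinates, then
  \<open>P\<close> reaches into their corner.
\<close>
locale spread_vertices = distant_vertices k I P u v
  for k :: nat and I :: "'n::finite set" and P :: "(real ^ 'n) set" and u v :: "real ^ 'n" +
  assumes k3: "3 \<le> k" and card_I: "3 \<le> card I"
    and triple: "\<And>\<sigma> i j l a b w z. i \<in> I \<Longrightarrow> j \<in> I \<Longrightarrow> l \<in> I \<Longrightarrow> i \<noteq> j \<Longrightarrow> i \<noteq> l \<Longrightarrow> j \<noteq> l \<Longrightarrow>
      (u, w) \<in> polytope_edges P ^^ a \<Longrightarrow> (v, z) \<in> polytope_edges P ^^ b \<Longrightarrow>
      3 * int k - int (a + b + 1) \<le>
        room k \<sigma> w i + room k \<sigma> w j + room k \<sigma> w l + room k \<sigma> z i + room k \<sigma> z j + room k \<sigma> z l"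
    and pair_corner: "\<And>\<sigma> i j a b w z. i \<in> I \<Longrightarrow> j \<in> I \<Longrightarrow> i \<noteq> j \<Longrightarrow>
      (u, w) \<in> polytope_edges P ^^ a \<Longrightarrow> (v, z) \<in> polytope_edges P ^^ b \<Longrightarrow>
      room k \<sigma> w i + room k \<sigma> w j + room k \<sigma> z i + room k \<sigma> z j = 2 * int k - int (a + b + 1) \<Longrightarrow>
      \<exists>y\<in>polytope_vertices P. room k \<sigma> y i = 0 \<and> room k \<sigma> y j = 0"
begin

lemma spread_swapped: "spread_vertices k I P v u"
proof -
  interpret S: distant_vertices k I P v u by (rule swapped)
  show ?thesis
  proof
    show "3 * int k - int (a + b + 1) \<le>
        room k \<sigma> w i + room k \<sigma> w j + room k \<sigma> w l + room k \<sigma> z i + room k \<sigma> z j + room k \<sigma> z l"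
      if "i \<in> I" "j \<in> I" "l \<in> I" "i \<noteq> j" "i \<noteq> l" "j \<noteq> l" "(v, w) \<in> E ^^ a" "(u, z) \<in> E ^^ b"
      for \<sigma> i j l a b w z
      using triple[OF that(1-6,8,7), of \<sigma>] by (simp add: algebra_simps)
    show "\<exists>y\<in>polytope_vertices P. room k \<sigma> y i = 0 \<and> room k \<sigma> y j = 0"
      if "i \<in> I" "j \<in> I" "i \<noteq> j" "(v, w) \<in> E ^^ a" "(u, z) \<in> E ^^ b"
        "room k \<sigma> w i + room k \<sigma> w j + room k \<sigma> z i + room k \<sigma> z j = 2 * int k - int (a + b + 1)"
      for \<sigma> i j a b w z
      using pair_corner[OF that(1-3,5,4), of \<sigma>] that(6) by (simp add: algebra_simps)
  qed (use k3 card_I in auto)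
qed

lemma third_coordinate: obtains l where "l \<in> I" "l \<noteq> i" "l \<noteq> j"
proof -
  have "card {i, j} < card I" using card_I card_insert_le_m1[of 2 "{j}" i] by simp
  then have "\<not> I \<subseteq> {i, j}" using card_mono[of "{i, j}" I] by auto
  then show ?thesis using that by auto
qed

text \<open>
  When one step has been saved on \<open>i\<close> and \<open>j\<close>, a third coordinate \<open>l\<close> must be in balance, since the
  excess of \<open>u + v\<close> over \<open>k\<close> at \<open>l\<close> counts as a saving towards one of the two sides at \<open>l\<close>.
\<close>
lemma other_coordinate_tight:
  assumes ijl: "i \<in> I" "j \<in> I" "l \<in> I" "i \<noteq> j" "l \<noteq> i" "l \<noteq> j"
    and w: "(u, w) \<in> E ^^ a" and z: "(v, z) \<in> E ^^ b"
    and le: "room k \<sigma> w i + room k \<sigma> w j + room k \<sigma> z i + room k \<sigma> z j \<le> 2 * int k - int (a + b + 1)"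
  shows "room k \<sigma> w i + room k \<sigma> w j + room k \<sigma> z i + room k \<sigma> z j = 2 * int k - int (a + b + 1)"
    and "room k \<sigma> w l + room k \<sigma> z l = int k"
proof -
  let ?\<tau> = "\<lambda>m. if m = l then \<not> \<sigma> l else \<sigma> m"
  have t: "room k ?\<tau> x l = int k - room k \<sigma> x l" "room k ?\<tau> x i = room k \<sigma> x i"
    "room k ?\<tau> x j = room k \<sigma> x j" for x
    using ijl by (simp_all add: room_flip[of ?\<tau> l \<sigma>] room_cong[of ?\<tau> _ \<sigma>])
  have 1: "3 * int k - int (a + b + 1) \<le> room k \<sigma> w i + room k \<sigma> w j + room k \<sigma> w l +
      room k \<sigma> z i + room k \<sigma> z j + room k \<sigma> z l"
    using ijl by (intro triple[OF _ _ _ _ _ _ w z]) auto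
  have 2: "3 * int k - int (a + b + 1) \<le> room k ?\<tau> w i + room k ?\<tau> w j + room k ?\<tau> w l +
      room k ?\<tau> z i + room k ?\<tau> z j + room k ?\<tau> z l"
    using ijl by (intro triple[OF _ _ _ _ _ _ w z]) auto
  show "room k \<sigma> w i + room k \<sigma> w j + room k \<sigma> z i + room k \<sigma> z j = 2 * int k - int (a + b + 1)"
    "room k \<sigma> w l + room k \<sigma> z l = int k"
    using 1 2 le unfolding t by linarith+
qed

text \<open>
  The next step towards the corner of \<open>i\<close> and \<open>j\<close> neither saves again nor
  moves a third coordinate; it is therefore \<open>(\<alpha>, 1 - \<alpha>)\<close> in the plane of \<open>i\<close> and \<open>j\<close>.
\<close>
lemma planar_step:
  assumes ij: "i \<in> I" "j \<in> I" "i \<noteq> j"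
    and w: "(u, w) \<in> E ^^ a" and z: "(v, z) \<in> E ^^ b"
    and state: "room k \<sigma> w i + room k \<sigma> w j + room k \<sigma> z i + room k \<sigma> z j = 2 * int k - int (a + b + 1)"
    and pos: "0 < room k \<sigma> w i + room k \<sigma> w j"
  shows "\<exists>q \<alpha>. (w, q) \<in> E \<and> (u, q) \<in> E ^^ Suc a \<and> axis_coplanar i j w q \<and>
    room k \<sigma> q i = room k \<sigma> w i - \<alpha> \<and> room k \<sigma> q j = room k \<sigma> w j - (1 - \<alpha>)"
proof -
  have wV: "w \<in> polytope_vertices P" using relpow_edges_vertex[OF w u] .
  obtain y where y: "y \<in> polytope_vertices P" "room k \<sigma> y i = 0" "room k \<sigma> y j = 0"
    using pair_corner[OF ij w z state] by blast
  have "total_room k \<sigma> {i, j} y < total_room k \<sigma> {i, j} w"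
    using y pos ij by (simp add: total_room_def)
  then obtain q where q: "(w, q) \<in> E" "q \<in> polytope_vertices P"
      "total_room k \<sigma> {i, j} q < total_room k \<sigma> {i, j} w"
    using room_decreasing_edge[OF cube wV y(1)] by blast
  have less: "room k \<sigma> q i + room k \<sigma> q j < room k \<sigma> w i + room k \<sigma> w j"
    using q(3) ij by (simp add: total_room_def)
  have uq: "(u, q) \<in> E ^^ Suc a" using w q(1) by auto
  have le: "room k \<sigma> q i + room k \<sigma> q j + room k \<sigma> z i + room k \<sigma> z j \<le> 2 * int k - int (Suc a + b + 1)"
    using less state by simp
  obtain l0 where l0: "l0 \<in> I" "l0 \<noteq> i" "l0 \<noteq> j" using third_coordinate .
  have eq: "room k \<sigma> q i + room k \<sigma> q j + room k \<sigma> z i + room k \<sigma> z j = 2 * int k - int (Suc a + b + 1)"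
    using other_coordinate_tight(1)[OF ij(1,2) l0(1) ij(3) l0(2,3) uq z le] .
  have "w $ l = q $ l" if l: "l \<noteq> i" "l \<noteq> j" for l
  proof (cases "l \<in> I")
    case True
    have "room k \<sigma> q l + room k \<sigma> z l = int k"
      using other_coordinate_tight(2)[OF ij(1,2) True ij(3) l uq z le] .
    moreover have "room k \<sigma> w l + room k \<sigma> z l = int k"
      using other_coordinate_tight(2)[OF ij(1,2) True ij(3) l w z] state by simp
    ultimately show ?thesis using room_eq_iff[OF cube wV q(2), of \<sigma> l] by simp
  next
    case False
    then show ?thesis using vertices_agree_outside[OF wV q(2)] by simp
  qed
  then have "axis_coplanar i j w q" by (simp add: axis_coplanar_def)
  moreover have "room k \<sigma> q j = room k \<sigma> w j - (1 - (room k \<sigma> w i - room k \<sigma> q i))"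
    using eq state by simp
  ultimately show ?thesis
    using q(1) uq by (intro exI[of _ q] exI[of _ "room k \<sigma> w i - room k \<sigma> q i"]) simp
qed

text \<open>
  Here \<open>u\<close> is a corner of the cube at distance \<open>(k, k)\<close> from the corner of \<open>i\<close> and \<open>j\<close>. The walk
  towards that corner begins with the steps \<open>(1, 0)\<close> and \<open>(1, 1)\<close>, which saves one step. All
  further steps turn the same way, which leaves \<open>(0, 1)\<close> and \<open>(- 1, 2)\<close> before the bound for
  coordinate \<open>j\<close> excludes a fifth step. After these four steps the walk has arrived at \<open>(1, 4)\<close>,
  short of \<open>(k, k)\<close>.
\<close>
lemma no_axis_parallel_edges:
  assumes ax: axis_parallel_edges
  shows False
proof -
  obtain i where i: "i \<in> I" using third_coordinate by blast
  have k2: "2 \<le> k" using k3 by simp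
  obtain p q j where p: "(u, p) \<in> E" "(p, q) \<in> E" "\<And>l. l \<noteq> i \<Longrightarrow> p $ l = u $ l"
    "room k inward p i = int k - 1" "room k inward q i = int k - 2"
    and j: "j \<in> I" "j \<noteq> i" "room k inward q j < int k"
    using two_steps_if_axis_parallel[OF ax i k2] by blast
  let ?r = "room k inward"
  have ui: "?r u i = int k" and uj: "?r u j = int k"
    using corner_if_axis_parallel[OF ax] i j by auto
  have vi: "?r v i = 0" and vj: "?r v j = 0"
    using opposite[OF i, of inward] opposite[OF j(1), of inward] ui uj by auto
  have uq: "(u, q) \<in> E ^^ 2" using p(1,2) by (auto simp: numeral_2_eq_2)
  have v0: "(v, v) \<in> E ^^ 0" by simp
  have uV: "u \<in> polytope_vertices P" and pV: "p \<in> polytope_vertices P" and qV: "q \<in> polytope_vertices P"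
    using u edge_vertices[OF p(2)] by auto
  have le: "?r q i + ?r q j + ?r v i + ?r v j \<le> 2 * int k - int (2 + 0 + 1)"
    using p(5) j(3) vi vj by simp
  obtain l0 where l0: "l0 \<in> I" "l0 \<noteq> i" "l0 \<noteq> j" using third_coordinate .
  have eq: "?r q i + ?r q j + ?r v i + ?r v j = 2 * int k - int (2 + 0 + 1)"
    using other_coordinate_tight(1)[OF i j(1) l0(1) j(2)[symmetric] l0(2,3) uq v0 le] .
  have qj: "?r q j = int k - 1" using eq p(5) vi vj by simp
  have pj: "?r p j = int k" using p(3)[OF j(2)] room_eq_iff[OF cube pV uV, of inward j] uj by simp
  have "p $ l = q $ l" if l: "l \<noteq> i" "l \<noteq> j" for l
  proof (cases "l \<in> I")
    case True
    have "?r q l + ?r v l = int k"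
      using other_coordinate_tight(2)[OF i j(1) True j(2)[symmetric] l uq v0 le] .
    then have "?r q l = ?r u l" using opposite[OF True, of inward] by simp
    then show ?thesis using p(3)[OF l(1)] room_eq_iff[OF cube qV uV, of inward l] by simp
  next
    case False
    then show ?thesis using vertices_agree_outside[OF pV qV] by simp
  qed
  then have plane: "axis_coplanar i j u p" "axis_coplanar i j p q"
    using p(3) by (auto simp: axis_coplanar_def)
  obtain x \<alpha> where x: "(q, x) \<in> E" "(u, x) \<in> E ^^ Suc 2" "axis_coplanar i j q x"
      "?r x i = ?r q i - \<alpha>" "?r x j = ?r q j - (1 - \<alpha>)"
    using planar_step[OF i j(1) j(2)[symmetric] uq v0 eq] p(5) qj k3 by auto
  have "0 < turn k inward i j u p q * turn k inward i j p q x"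
    using x p(5) qj pj uj p(4) ui by (intro turns_agree[OF cube p(1,2) x(1) j(2)[symmetric] _ _ plane x(3)]) auto
  then have \<alpha>: "\<alpha> \<le> 0" by (simp add: turn_def ui uj p(4,5) pj qj x)
  have \<alpha>': "-1 \<le> \<alpha>" using single[OF j(1) x(2) v0, of inward] x(5) qj vj by simp
  have eqx: "?r x i + ?r x j + ?r v i + ?r v j = 2 * int k - int (Suc 2 + 0 + 1)"
    using x p(5) qj vi vj by simp
  obtain y \<beta> where y: "(x, y) \<in> E" "(u, y) \<in> E ^^ Suc (Suc 2)" "axis_coplanar i j x y"
      "?r y i = ?r x i - \<beta>" "?r y j = ?r x j - (1 - \<beta>)"
    using planar_step[OF i j(1) j(2)[symmetric] x(2) v0 eqx] x(4,5) p(5) qj k3 by auto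
  have "p \<noteq> x" using x p qj pj by auto
  have "q \<noteq> y"
  proof
    assume "q = y"
    then show False using y(4,5) x(4,5) by simp
  qed
  have "0 < turn k inward i j p q x * turn k inward i j q x y"
    by (rule turns_agree[OF cube p(2) x(1) y(1) j(2)[symmetric] \<open>p \<noteq> x\<close> \<open>q \<noteq> y\<close> plane(2) x(3) y(3)])
  then have "0 < (1 - 2 * \<alpha>) * (\<alpha> - \<beta>)"
    by (simp add: turn_def p(4,5) pj qj x(4,5) y(4,5) algebra_simps)
  then have \<beta>: "\<beta> < \<alpha>" using \<alpha> by (auto simp: zero_less_mult_iff)
  have \<beta>': "-1 \<le> \<alpha> + \<beta>" using single[OF j(1) y(2) v0, of inward] y(5) x(5) qj vj by simp
  have \<alpha>\<beta>: "\<alpha> = 0" "\<beta> = -1" using \<alpha> \<alpha>' \<beta> \<beta>' by auto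
  have eqy: "?r y i + ?r y j + ?r v i + ?r v j = 2 * int k - int (Suc (Suc 2) + 0 + 1)"
    using y(4,5) eqx by simp
  have "0 \<le> ?r y j" using room_range(1)[OF cube edge_vertices(2)[OF y(1)]] .
  then have "0 < ?r y i + ?r y j" using y(4,5) x(4,5) p(5) qj \<alpha>\<beta> k3 by simp
  then obtain t \<gamma> where t: "(y, t) \<in> E" "(u, t) \<in> E ^^ Suc (Suc (Suc 2))" "axis_coplanar i j y t"
      "?r t i = ?r y i - \<gamma>" "?r t j = ?r y j - (1 - \<gamma>)"
    using planar_step[OF i j(1) j(2)[symmetric] y(2) v0 eqy] by auto
  have "x \<noteq> t"
  proof
    assume "x = t"
    then show False using t(4,5) y(4,5) by simp
  qed
  have "0 < turn k inward i j q x y * turn k inward i j x y t"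
    by (rule turns_agree[OF cube x(1) y(1) t(1) j(2)[symmetric] \<open>q \<noteq> y\<close> \<open>x \<noteq> t\<close> x(3) y(3) t(3)])
  then have "0 < (\<alpha> - \<beta>) * (\<beta> - \<gamma>)"
    by (simp add: turn_def x(4,5) y(4,5) t(4,5) algebra_simps)
  then have "\<gamma> < \<beta>" using \<beta> by (auto simp: zero_less_mult_iff)
  moreover have "int k - 5 \<le> ?r t j" using single[OF j(1) t(2) v0, of inward] vj by simp
  ultimately show False using t(5) y(5) x(5) qj \<alpha>\<beta> by simp
qed

end

context spread_vertices
begin

text \<open>
  One step has been saved from \<open>v\<close>, so all steps from \<open>u\<close> towards the corner are \<open>(\<alpha>, 1 - \<alpha>)\<close> with
  monotone \<open>\<alpha>\<close>. The bounds for single rooms confine their partial sums; for a walk of three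
  steps they leave \<open>\<alpha> = 1, 0, - 1\<close> or \<open>\<alpha> = 0, 1, 2\<close>, and no fourth step. But these walks end at
  \<open>(0, 3)\<close> or \<open>(3, 0)\<close>, and they have passed a point that is nearer at the other coordinate, so
  they cannot have reached the corner.
\<close>
lemma room_near_corner:
  assumes ij: "i \<in> I" "j \<in> I" "i \<noteq> j" and z: "(v, z) \<in> E ^^ 1"
    and zi: "room k \<sigma> z i = room k \<sigma> v i - 1" and zj: "room k \<sigma> z j = room k \<sigma> v j - 1"
  shows "room k \<sigma> u i + room k \<sigma> u j \<le> 2"
proof (rule ccontr)
  assume "\<not> ?thesis"
  then have big: "3 \<le> room k \<sigma> u i + room k \<sigma> u j" by simp
  let ?r = "room k \<sigma>"
  have op: "?r v i = int k - ?r u i" "?r v j = int k - ?r u j"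
    using opposite[OF ij(1), of \<sigma>] opposite[OF ij(2), of \<sigma>] by simp_all
  have bounds: "?r u i - ?r x i \<le> int n" "?r u j - ?r x j \<le> int n"
    if "(u, x) \<in> E ^^ n" for x n
    using single[OF ij(1) that z, of \<sigma>] single[OF ij(2) that z, of \<sigma>] zi zj op by simp_all
  have step: "\<exists>y \<beta>. (x, y) \<in> E \<and> (u, y) \<in> E ^^ Suc n \<and> axis_coplanar i j x y \<and>
      ?r y i = ?r x i - \<beta> \<and> ?r y j = ?r x j - (1 - \<beta>) \<and>
      ?r y i + ?r y j = ?r u i + ?r u j - int (Suc n)"
    if "(u, x) \<in> E ^^ n" "?r x i + ?r x j = ?r u i + ?r u j - int n" "0 < ?r x i + ?r x j" for x n
  proof -
    have "?r x i + ?r x j + ?r z i + ?r z j = 2 * int k - int (n + 1 + 1)"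
      using that(2) zi zj op by simp
    from planar_step[OF ij that(1) z this that(3)] show ?thesis using that(2) by force
  qed
  have u0: "(u, u) \<in> E ^^ 0" by simp
  obtain x1 a1 where x1: "(u, x1) \<in> E" "(u, x1) \<in> E ^^ Suc 0" "axis_coplanar i j u x1"
    "?r x1 i = ?r u i - a1" "?r x1 j = ?r u j - (1 - a1)" "?r x1 i + ?r x1 j = ?r u i + ?r u j - int (Suc 0)"
    using step[OF u0] big by auto
  have "0 < ?r x1 i + ?r x1 j" using x1(6) big by simp
  from step[OF x1(2,6) this]
  obtain x2 a2 where x2: "(x1, x2) \<in> E" "(u, x2) \<in> E ^^ Suc (Suc 0)" "axis_coplanar i j x1 x2"
    "?r x2 i = ?r x1 i - a2" "?r x2 j = ?r x1 j - (1 - a2)"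
    "?r x2 i + ?r x2 j = ?r u i + ?r u j - int (Suc (Suc 0))"
    by blast
  have "0 < ?r x2 i + ?r x2 j" using x2(6) big by simp
  from step[OF x2(2,6) this]
  obtain x3 a3 where x3: "(x2, x3) \<in> E" "(u, x3) \<in> E ^^ Suc (Suc (Suc 0))" "axis_coplanar i j x2 x3"
    "?r x3 i = ?r x2 i - a3" "?r x3 j = ?r x2 j - (1 - a3)"
    "?r x3 i + ?r x3 j = ?r u i + ?r u j - int (Suc (Suc (Suc 0)))"
    by blast
  have ne: "u \<noteq> x2" "x1 \<noteq> x3" using x1(6) x2(6) x3(6) by auto
  have "turn k \<sigma> i j u x1 x2 \<noteq> 0"
    using ne edge_vertices[OF x1(1)] edge_vertices[OF x2(1)] axis_coplanar_trans[OF x1(3) x2(3)]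
    by (intro turn_nonzero[OF cube x1(1) ij(3) _ _ _ x1(3)]) auto
  then have a12: "a1 \<noteq> a2" by (simp add: turn_def x1(4,5) x2(4,5) algebra_simps)
  have "0 < turn k \<sigma> i j u x1 x2 * turn k \<sigma> i j x1 x2 x3"
    by (rule turns_agree[OF cube x1(1) x2(1) x3(1) ij(3) ne x1(3) x2(3) x3(3)])
  then have "0 < (a1 - a2) * (a2 - a3)"
    by (simp add: turn_def x1(4,5) x2(4,5) x3(4,5) algebra_simps)
  then have mono: "a1 < a2 \<and> a2 < a3 \<or> a3 < a2 \<and> a2 < a1" by (auto simp: zero_less_mult_iff)
  have b: "a1 \<le> 1" "0 \<le> a1" "a1 + a2 \<le> 2" "0 \<le> a1 + a2" "a1 + a2 + a3 \<le> 3" "0 \<le> a1 + a2 + a3"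
    using bounds[OF x1(2)] bounds[OF x2(2)] bounds[OF x3(2)] x1(4,5) x2(4,5) x3(4,5) by simp_all
  then have "a1 = 0 \<or> a1 = 1" by linarith
  then have a: "a1 = 1 \<and> a2 = 0 \<and> a3 = -1 \<or> a1 = 0 \<and> a2 = 1 \<and> a3 = 2" using b mono by auto
  have "0 \<le> ?r x1 i" "0 \<le> ?r x1 j" "0 \<le> ?r x3 i" "0 \<le> ?r x3 j"
    using room_range(1)[OF cube] edge_vertices(2)[OF x1(1)] edge_vertices(2)[OF x3(1)] by blast+
  then have "0 < ?r x3 i + ?r x3 j" using a x1(4,5) x2(4,5) x3(4,5) by auto
  from step[OF x3(2,6) this]
  obtain x4 a4 where x4: "(x3, x4) \<in> E" "(u, x4) \<in> E ^^ Suc (Suc (Suc (Suc 0)))" "axis_coplanar i j x3 x4"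
    "?r x4 i = ?r x3 i - a4" "?r x4 j = ?r x3 j - (1 - a4)"
    "?r x4 i + ?r x4 j = ?r u i + ?r u j - int (Suc (Suc (Suc (Suc 0))))"
    by blast
  have ne': "x2 \<noteq> x4" using x2(6) x4(6) by auto
  have "0 < turn k \<sigma> i j x1 x2 x3 * turn k \<sigma> i j x2 x3 x4"
    by (rule turns_agree[OF cube x2(1) x3(1) x4(1) ij(3) ne(2) ne' x2(3) x3(3) x4(3)])
  then have "0 < (a2 - a3) * (a3 - a4)"
    by (simp add: turn_def x2(4,5) x3(4,5) x4(4,5) algebra_simps)
  then have "a4 < -1 \<and> a3 = -1 \<or> 2 < a4 \<and> a3 = 2" using a by (auto simp: zero_less_mult_iff)
  moreover have "a1 + a2 + a3 + a4 \<le> 4" "0 \<le> a1 + a2 + a3 + a4"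
    using bounds[OF x4(2)] x1(4,5) x2(4,5) x3(4,5) x4(4,5) by simp_all
  ultimately show False using a by auto
qed

text \<open>
  After the step \<open>(1, 1)\<close>, which saves one, at most one step \<open>(0, 1)\<close> or \<open>(1, 0)\<close> can follow: the
  next one would have to turn further in the same sense, beyond the bound for a single room.
\<close>
lemma room_after_oblique_edge:
  assumes ij: "i \<in> I" "j \<in> I" "i \<noteq> j" and w: "(u, w) \<in> E" "axis_coplanar i j u w"
    and wi: "room k \<sigma> w i = room k \<sigma> u i - 1" and wj: "room k \<sigma> w j = room k \<sigma> u j - 1"
  shows "room k \<sigma> u i + room k \<sigma> u j \<le> 3"
proof (rule ccontr)
  assume "\<not> ?thesis"
  then have big: "4 \<le> room k \<sigma> u i + room k \<sigma> u j" by simp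
  let ?r = "room k \<sigma>"
  have op: "?r v i = int k - ?r u i" "?r v j = int k - ?r u j"
    using opposite[OF ij(1), of \<sigma>] opposite[OF ij(2), of \<sigma>] by simp_all
  have v0: "(v, v) \<in> E ^^ 0" by simp
  have bounds: "?r u i - ?r x i \<le> int n" "?r u j - ?r x j \<le> int n"
    if "(u, x) \<in> E ^^ n" for x n
    using single[OF ij(1) that v0, of \<sigma>] single[OF ij(2) that v0, of \<sigma>] op by simp_all
  have uw: "(u, w) \<in> E ^^ Suc 0" using w(1) by simp
  have "?r w i + ?r w j + ?r v i + ?r v j = 2 * int k - int (Suc 0 + 0 + 1)" using wi wj op by simp
  moreover have "0 < ?r w i + ?r w j" using big wi wj by simp
  ultimately obtain x a where x: "(w, x) \<in> E" "(u, x) \<in> E ^^ Suc (Suc 0)" "axis_coplanar i j w x"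
      "?r x i = ?r w i - a" "?r x j = ?r w j - (1 - a)"
    using planar_step[OF ij uw v0] by blast
  have "?r x i + ?r x j + ?r v i + ?r v j = 2 * int k - int (Suc (Suc 0) + 0 + 1)"
    using wi wj op x(4,5) by simp
  moreover have "0 < ?r x i + ?r x j" using big wi wj x(4,5) by simp
  ultimately obtain y b where y: "(x, y) \<in> E" "(u, y) \<in> E ^^ Suc (Suc (Suc 0))" "axis_coplanar i j x y"
      "?r y i = ?r x i - b" "?r y j = ?r x j - (1 - b)"
    using planar_step[OF ij x(2) v0] by blast
  have a: "a = 0 \<or> a = 1" using bounds[OF x(2)] wi wj x(4,5) by auto
  have ne: "u \<noteq> x" "w \<noteq> y"
  proof -
    have "?r x i + ?r x j < ?r u i + ?r u j" using wi wj x(4,5) by simp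
    then show "u \<noteq> x" by auto
    have "?r y i + ?r y j < ?r w i + ?r w j" using x(4,5) y(4,5) by simp
    then show "w \<noteq> y" by auto
  qed
  have "0 < turn k \<sigma> i j u w x * turn k \<sigma> i j w x y"
    by (rule turns_agree[OF cube w(1) x(1) y(1) ij(3) ne w(2) x(3) y(3)])
  then have "0 < (1 - 2 * a) * (a - b)"
    by (simp add: turn_def wi wj x(4,5) y(4,5) algebra_simps)
  then have "a = 0 \<and> b < 0 \<or> a = 1 \<and> 1 < b" using a by (auto simp: zero_less_mult_iff)
  moreover have "1 + a + b \<le> 3" "3 - a - b \<le> 3" using bounds[OF y(2)] wi wj x(4,5) y(4,5) by simp_all
  ultimately show False by auto
qed

text \<open>
  If an edge at \<open>u\<close> changes two coordinates, then the two rooms in its direction have sum at most \<open>3\<close>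
  at \<open>u\<close> and at most \<open>2\<close> at \<open>v\<close>, while all four of them add up to \<open>2k \<ge> 6\<close>.
\<close>
lemma edges_axis_parallel: axis_parallel_edges
  unfolding axis_parallel_edges_def
proof (intro allI impI, rule ccontr)
  fix w i j assume w: "(u, w) \<in> E" and ij: "i \<in> I" "j \<in> I" "i \<noteq> j"
    and "\<not> (w $ i = u $ i \<or> w $ j = u $ j)"
  then have ne: "w $ i \<noteq> u $ i" "w $ j \<noteq> u $ j" by auto
  define \<sigma> where "\<sigma> = (\<lambda>l. u $ l < w $ l)"
  have wV: "w \<in> polytope_vertices P" using edge_vertices(2)[OF w] .
  have less: "room k \<sigma> w l < room k \<sigma> u l" if "w $ l \<noteq> u $ l" for l
    unfolding \<sigma>_def using room_decreases_towards[OF cube u wV that] .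
  have op: "room k \<sigma> v l = int k - room k \<sigma> u l" if "l \<in> I" for l using opposite[OF that, of \<sigma>] by simp
  have uw: "(u, w) \<in> E ^^ 1" and v0: "(v, v) \<in> E ^^ 0" using w by simp_all
  have wi: "room k \<sigma> w i = room k \<sigma> u i - 1" and wj: "room k \<sigma> w j = room k \<sigma> u j - 1"
    using less[OF ne(1)] less[OF ne(2)] single[OF ij(1) uw v0, of \<sigma>] single[OF ij(2) uw v0, of \<sigma>]
      op[OF ij(1)] op[OF ij(2)] by auto
  have state: "room k \<sigma> w i + room k \<sigma> w j + room k \<sigma> v i + room k \<sigma> v j \<le> 2 * int k - int (1 + 0 + 1)"
    using wi wj op[OF ij(1)] op[OF ij(2)] by simp
  have "u $ l = w $ l" if l: "l \<noteq> i" "l \<noteq> j" for l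
  proof (cases "l \<in> I")
    case True
    have "room k \<sigma> w l + room k \<sigma> v l = int k"
      using other_coordinate_tight(2)[OF ij(1,2) True ij(3) l uw v0 state] .
    then show ?thesis using less[of l] op[OF True] by fastforce
  next
    case False
    then show ?thesis using vertices_agree_outside[OF u wV] by simp
  qed
  then have plane: "axis_coplanar i j u w" by (simp add: axis_coplanar_def)
  interpret S: spread_vertices k I P v u by (rule spread_swapped)
  have "room k \<sigma> u i + room k \<sigma> u j \<le> 3" using room_after_oblique_edge[OF ij w plane wi wj] .
  moreover have "room k \<sigma> v i + room k \<sigma> v j \<le> 2" using S.room_near_corner[OF ij uw wi wj] .
  ultimately show False using op[OF ij(1)] op[OF ij(2)] k3 by simp
qed

theorem no_spread_vertices: False
  using no_axis_parallel_edges[OF edges_axis_parallel] .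

end

section \<open>Recursion on the number of coordinates\<close>

lemma distant_total_room:
  fixes S :: "'n::finite set"
  assumes P: "cube_polytope k I P" and u: "u \<in> polytope_vertices P" and v: "v \<in> polytope_vertices P"
    and far: "\<not> reaches (polytope_edges P) N u v"
    and w: "(u, w) \<in> polytope_edges P ^^ a" and z: "(v, z) \<in> polytope_edges P ^^ b"
    and S: "S \<noteq> {}" and bound: "diameter_bound k (I - S) B"
  obtains y where "y \<in> polytope_vertices P" "0 \<le> total_room k \<sigma> S y"
    "int N < int (a + b) + int B + total_room k \<sigma> S w + total_room k \<sigma> S z +
      (int (card S) - 3) * total_room k \<sigma> S y"
proof -
  let ?E = "polytope_edges P"
  obtain y where y: "y \<in> polytope_vertices P" "0 \<le> total_room k \<sigma> S y"
    "0 \<le> total_room k \<sigma> S w + total_room k \<sigma> S z + (int (card S) - 3) * total_room k \<sigma> S y"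
    "reaches ?E (nat (total_room k \<sigma> S w + total_room k \<sigma> S z +
      (int (card S) - 3) * total_room k \<sigma> S y) + B) w z"
    using reaches_via_corner[OF P relpow_edges_vertex[OF w u] relpow_edges_vertex[OF z v] S bound]
    by blast
  let ?T = "total_room k \<sigma> S w + total_room k \<sigma> S z + (int (card S) - 3) * total_room k \<sigma> S y"
  have "reaches ?E a u w" "reaches ?E b v z" using w z unfolding reaches_def by blast+
  then have "reaches ?E (a + (nat ?T + B) + b) u v"
    using y(4) reaches_sym[OF sym_polytope_edges] by (blast intro: reaches_trans)
  then have "\<not> a + (nat ?T + B) + b \<le> N" using far by (blast intro: reaches_mono)
  then have "int N < int (a + b) + int B + ?T" using y(3) by linarith
  then show ?thesis using that[OF y(1,2)] by (simp add: add.assoc)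
qed

lemma distant_room:
  fixes P :: "(real ^ 'n) set"
  assumes P: "cube_polytope k I P" and u: "u \<in> polytope_vertices P" and v: "v \<in> polytope_vertices P"
    and far: "\<not> reaches (polytope_edges P) N u v"
    and w: "(u, w) \<in> polytope_edges P ^^ a" and z: "(v, z) \<in> polytope_edges P ^^ b"
    and bound: "diameter_bound k (I - {i}) B"
  obtains y where "y \<in> polytope_vertices P" "0 \<le> room k \<sigma> y i"
    "int N < int (a + b) + int B + room k \<sigma> w i + room k \<sigma> z i - 2 * room k \<sigma> y i"
proof -
  obtain y where "y \<in> polytope_vertices P" "0 \<le> total_room k \<sigma> {i} y"
    "int N < int (a + b) + int B + total_room k \<sigma> {i} w + total_room k \<sigma> {i} z +
      (int (card {i}) - 3) * total_room k \<sigma> {i} y"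
    using distant_total_room[OF P u v far w z _ bound] by blast
  then show ?thesis using that by (simp add: total_room_def)
qed

lemma reaches_through_facet:
  fixes P :: "(real ^ 'n) set"
  assumes P: "cube_polytope k I P" and u: "u \<in> polytope_vertices P" and v: "v \<in> polytope_vertices P"
    and bound: "diameter_bound k (I - {i}) B" and N: "B + k \<le> N"
  shows "reaches (polytope_edges P) N u v"
proof (rule ccontr)
  assume far: "\<not> ?thesis"
  let ?t = "\<lambda>_::'n. True" and ?f = "\<lambda>_::'n. False"
  have 0: "(u, u) \<in> polytope_edges P ^^ 0" "(v, v) \<in> polytope_edges P ^^ 0" by simp_all
  have "int N < int B + room k \<sigma> u i + room k \<sigma> v i" for \<sigma>
    using distant_room[OF P u v far 0 bound, of \<sigma>] by force
  from this[of ?t] this[of ?f] show False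
    using N by (simp add: room_flip[of ?f _ ?t])
qed

lemma distant_verticesI:
  fixes P :: "(real ^ 'n) set"
  assumes P: "cube_polytope k I P" and u: "u \<in> polytope_vertices P" and v: "v \<in> polytope_vertices P"
    and far: "\<not> reaches (polytope_edges P) N u v"
    and bound: "\<And>i. i \<in> I \<Longrightarrow> diameter_bound k (I - {i}) B" and N: "B + k \<le> N + 1"
  shows "distant_vertices k I P u v"
proof
  show single: "int k - int (a + b) \<le> room k \<sigma> w i + room k \<sigma> z i"
    if i: "i \<in> I" and wz: "(u, w) \<in> polytope_edges P ^^ a" "(v, z) \<in> polytope_edges P ^^ b"
    for \<sigma> i a b w z
  proof -
    obtain y where "0 \<le> room k \<sigma> y i"
      "int N < int (a + b) + int B + room k \<sigma> w i + room k \<sigma> z i - 2 * room k \<sigma> y i"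
      using distant_room[OF P u v far wz bound[OF i]] by blast
    then show ?thesis using N by linarith
  qed
  show "\<exists>y\<in>polytope_vertices P. room k \<sigma> y i = 0" if i: "i \<in> I" for \<sigma> i
  proof -
    let ?\<tau> = "\<lambda>l. \<not> \<sigma> l"
    have 0: "(u, u) \<in> polytope_edges P ^^ 0" "(v, v) \<in> polytope_edges P ^^ 0" by simp_all
    obtain y where y: "y \<in> polytope_vertices P" "0 \<le> room k \<sigma> y i"
      "int N < int (0 + 0) + int B + room k \<sigma> u i + room k \<sigma> v i - 2 * room k \<sigma> y i"
      using distant_room[OF P u v far 0 bound[OF i]] by blast
    have "int k - int (0 + 0) \<le> room k ?\<tau> u i + room k ?\<tau> v i" using single[OF i 0, of ?\<tau>] .
    then have "room k \<sigma> u i + room k \<sigma> v i \<le> int k" by (simp add: room_flip[of ?\<tau> _ \<sigma>])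
    then have "room k \<sigma> y i = 0" using y N by linarith
    then show ?thesis using y(1) by blast
  qed
qed (use P u v in auto)

lemma reaches_if_spread:
  fixes P :: "(real ^ 'n) set"
  assumes P: "cube_polytope k I P" and u: "u \<in> polytope_vertices P" and v: "v \<in> polytope_vertices P"
    and k: "3 \<le> k" and I: "3 \<le> card I"
    and bound: "\<And>S. S \<subseteq> I \<Longrightarrow> S \<noteq> {} \<Longrightarrow> diameter_bound k (I - S) (f (card S))"
    and N: "f 1 + k \<le> N + 1" "f 2 + 2 * k \<le> N + 2" "f 3 + 3 * k \<le> N + 2"
  shows "reaches (polytope_edges P) N u v"
proof (rule ccontr)
  assume far: "\<not> ?thesis"
  have "diameter_bound k (I - {i}) (f 1)" if "i \<in> I" for i
    using bound[of "{i}"] that by simp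
  then interpret distant_vertices k I P u v
    using distant_verticesI[OF P u v far _ N(1)] by blast
  have "spread_vertices k I P u v"
  proof
    show "3 * int k - int (a + b + 1) \<le>
        room k \<sigma> w i + room k \<sigma> w j + room k \<sigma> w l + room k \<sigma> z i + room k \<sigma> z j + room k \<sigma> z l"
      if ijl: "i \<in> I" "j \<in> I" "l \<in> I" "i \<noteq> j" "i \<noteq> l" "j \<noteq> l"
        and wz: "(u, w) \<in> E ^^ a" "(v, z) \<in> E ^^ b" for \<sigma> i j l a b w z
    proof -
      have S: "diameter_bound k (I - {i, j, l}) (f 3)" using bound[of "{i, j, l}"] ijl by (simp add: numeral_3_eq_3)
      obtain y where "int N < int (a + b) + int (f 3) + total_room k \<sigma> {i, j, l} w +
          total_room k \<sigma> {i, j, l} z + (int (card {i, j, l}) - 3) * total_room k \<sigma> {i, j, l} y"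
        using distant_total_room[OF P u v far wz _ S, of \<sigma>] by blast
      then show ?thesis using ijl N(3) by (simp add: total_room_def)
    qed
    show "\<exists>y\<in>polytope_vertices P. room k \<sigma> y i = 0 \<and> room k \<sigma> y j = 0"
      if ij: "i \<in> I" "j \<in> I" "i \<noteq> j" and wz: "(u, w) \<in> E ^^ a" "(v, z) \<in> E ^^ b"
        and sum: "room k \<sigma> w i + room k \<sigma> w j + room k \<sigma> z i + room k \<sigma> z j =
          2 * int k - int (a + b + 1)" for \<sigma> i j a b w z
    proof -
      have S: "diameter_bound k (I - {i, j}) (f 2)" using bound[of "{i, j}"] ij by (simp add: numeral_2_eq_2)
      obtain y where y: "y \<in> polytope_vertices P" "int N < int (a + b) + int (f 2) +
          total_room k \<sigma> {i, j} w + total_room k \<sigma> {i, j} z +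
          (int (card {i, j}) - 3) * total_room k \<sigma> {i, j} y"
        using distant_total_room[OF P u v far wz _ S, of \<sigma>] by blast
      then have "room k \<sigma> y i + room k \<sigma> y j \<le> 0" using ij sum N(2) by (simp add: total_room_def)
      then show ?thesis
        using y(1) room_range(1)[OF P y(1), of \<sigma> i] room_range(1)[OF P y(1), of \<sigma> j] by force
    qed
  qed (use k I in auto)
  then show False by (rule spread_vertices.no_spread_vertices)
qed

text \<open>
  Meant for three coordinates and \<open>k = 3\<close>: there \<open>\<delta>(1) + 2k - 1 = 6\<close>, so that a distance of \<open>7\<close> does
  not even allow one step to be saved on two coordinates, whereas the bound
  \<open>\<delta>(0) + 3k - 2 = 7\<close> would be too weak.
\<close>
lemma reaches_if_pairs_bounded:
  fixes P :: "(real ^ 'n) set"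
  assumes P: "cube_polytope k I P" and u: "u \<in> polytope_vertices P" and v: "v \<in> polytope_vertices P"
    and k: "2 \<le> k" and I: "I \<noteq> {}"
    and bound: "\<And>S. S \<subseteq> I \<Longrightarrow> S \<noteq> {} \<Longrightarrow> diameter_bound k (I - S) (f (card S))"
    and N: "f 1 + k \<le> N + 1" "f 2 + 2 * k \<le> N + 1"
  shows "reaches (polytope_edges P) N u v"
proof (rule ccontr)
  assume far: "\<not> ?thesis"
  have "diameter_bound k (I - {i}) (f 1)" if "i \<in> I" for i
    using bound[of "{i}"] that by simp
  then interpret distant_vertices k I P u v
    using distant_verticesI[OF P u v far _ N(1)] by blast
  obtain i0 where i0: "i0 \<in> I" using I by blast
  show False
  proof (rule pairs_not_tight[OF _ i0 k])
    show "2 * int k - int (a + b) \<le> room k \<sigma> w i + room k \<sigma> w j + room k \<sigma> z i + room k \<sigma> z j"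
      if ij: "i \<in> I" "j \<in> I" "i \<noteq> j" and wz: "(u, w) \<in> E ^^ a" "(v, z) \<in> E ^^ b"
      for \<sigma> i j a b w z
    proof -
      have S: "diameter_bound k (I - {i, j}) (f 2)" using bound[of "{i, j}"] ij by (simp add: numeral_2_eq_2)
      obtain y where y: "0 \<le> total_room k \<sigma> {i, j} y" "int N < int (a + b) + int (f 2) +
          total_room k \<sigma> {i, j} w + total_room k \<sigma> {i, j} z +
          (int (card {i, j}) - 3) * total_room k \<sigma> {i, j} y"
        using distant_total_room[OF P u v far wz _ S, of \<sigma>] by blast
      then show ?thesis using ij N(2) by (simp add: total_room_def)
    qed
  qed
qed

lemma diameter_bound_point: "diameter_bound k ({} :: 'n::finite set) 0"
  unfolding diameter_bound_def
proof (intro allI impI ballI)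
  fix P :: "(real ^ 'n) set" and u v assume "cube_polytope k {} P"
    and "u \<in> polytope_vertices P" "v \<in> polytope_vertices P"
  then have "u = v" unfolding cube_polytope_def vec_eq_iff by blast
  then show "reaches (polytope_edges P) 0 u v" by (simp add: reaches_refl)
qed

lemma diameter_bound_segment: "diameter_bound k {i :: 'n::finite} 1"
  unfolding diameter_bound_def
proof (intro allI impI ballI)
  fix P :: "(real ^ 'n) set" and u v assume P: "cube_polytope k {i} P"
    and uv: "u \<in> polytope_vertices P" "v \<in> polytope_vertices P"
  have agree: "x $ l = u $ l" if "x \<in> polytope_vertices P" "l \<noteq> i" for x l
    using P uv(1) that unfolding cube_polytope_def by blast
  show "reaches (polytope_edges P) 1 u v"
  proof (cases "u = v")
    case True
    then show ?thesis by (simp add: reaches_refl)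
  next
    case False
    then have ne: "v $ i \<noteq> u $ i" using agree[OF uv(2)] by (metis vec_eq_iff)
    let ?\<sigma> = "\<lambda>l. u $ l < v $ l"
    have "total_room k ?\<sigma> {i} v < total_room k ?\<sigma> {i} u"
      using room_decreases_towards[OF P uv ne] by (simp add: total_room_def)
    then obtain w where w: "(u, w) \<in> polytope_edges P" "w \<in> polytope_vertices P"
      using room_decreasing_edge[OF P uv] by blast
    have "v = u \<or> v = w"
      using agree w(2) uv(2) by (intro edge_not_collinear[OF P w(1) uv(2)]) blast+
    then have "v = w" using False by simp
    then have "(u, v) \<in> polytope_edges P ^^ 1" using w(1) by simp
    then show ?thesis unfolding reaches_def by blast
  qed
qed

text \<open>
  The right-hand sides for \<open>k \<ge> 4\<close> and for \<open>k = 3\<close> satisfy the same recursion; they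
  differ only in the initial value for two coordinates.
\<close>
fun diameter_value :: "nat \<Rightarrow> nat \<Rightarrow> nat" where
  "diameter_value k 0 = 0"
| "diameter_value k (Suc 0) = 1"
| "diameter_value k (Suc (Suc 0)) = (if k = 3 then 4 else k)"
| "diameter_value k (Suc (Suc (Suc 0))) = 2 * k"
| "diameter_value k (Suc (Suc (Suc (Suc m)))) = diameter_value k (Suc m) + (3 * k - 2)"

text \<open>
  The increments of the bound repeat with period three: two of them are \<open>k - 1\<close>, where
  one step has to be saved, and one is \<open>k\<close>, where a walk to any side of the cube suffices.
\<close>
lemma diameter_value_increments:
  assumes k: "3 \<le> k"
  shows "diameter_value k (m + 3) + k \<le> diameter_value k (m + 4) \<or>
    diameter_value k (m + 3) + k \<le> diameter_value k (m + 4) + 1 \<and>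
    diameter_value k (m + 2) + 2 * k \<le> diameter_value k (m + 4) + 2 \<and>
    diameter_value k (m + 1) + 3 * k \<le> diameter_value k (m + 4) + 2"
proof (induction m rule: less_induct)
  case (less m)
  consider "m = 0" | "m = 1" | "m = 2" | n where "m = Suc (Suc (Suc n))"
    by (metis One_nat_def not0_implies_Suc numeral_2_eq_2)
  then show ?case
  proof cases
    case 4
    have "n < m" using 4 by simp
    from less[OF this] show ?thesis unfolding 4 by (auto simp: numeral_eq_Suc)
  qed (use k in \<open>auto simp: numeral_eq_Suc\<close>)
qed

lemma diameter_bound_value:
  fixes I :: "'n::finite set"
  assumes k: "3 \<le> k"
  shows "diameter_bound k I (diameter_value k (card I))"
proof (induction "card I" arbitrary: I rule: less_induct)
  case less
  define f where "f s = diameter_value k (card I - s)" for s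
  have IH: "diameter_bound k (I - S) (f (card S))" if "S \<subseteq> I" "S \<noteq> {}" for S
  proof -
    have "card (I - S) = card I - card S" using that by (simp add: card_Diff_subset)
    moreover have "card (I - S) < card I" using that by (intro psubset_card_mono) auto
    ultimately show ?thesis using less[of "I - S"] by (simp add: f_def)
  qed
  have facet: "diameter_bound k I N" if N: "f 1 + k \<le> N" and ne: "I \<noteq> {}" for N
  proof -
    obtain i where "i \<in> I" using ne by blast
    then have "diameter_bound k (I - {i}) (f 1)" using IH[of "{i}"] by simp
    then show ?thesis
      unfolding diameter_bound_def[of k I] using reaches_through_facet N by blast
  qed
  have "card I = 0 \<or> card I = 1 \<or> card I = 2 \<or> card I = 3 \<or> (\<exists>m. card I = m + 4)"
    by presburger
  then consider "card I = 0" | "card I = 1" | "card I = 2" | "card I = 3" | m where "card I = m + 4"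
    by metis
  then show ?case
  proof cases
    case 1
    then show ?thesis using diameter_bound_point by simp
  next
    case 2
    then obtain i where "I = {i}" by (rule card_1_singletonE)
    then show ?thesis using diameter_bound_segment[of k i] by simp
  next
    case 3
    have f1: "f 1 = 1" by (simp add: f_def 3)
    show ?thesis
    proof (cases "k = 3")
      case True
      have "I \<noteq> {}" using 3 by auto
      then show ?thesis using facet[of 4] f1 True by (simp add: 3 numeral_2_eq_2)
    next
      case False
      then have k4: "4 \<le> k" using k by simp
      obtain i j where ij: "I = {i, j}" "i \<noteq> j" using 3 by (auto simp: card_2_iff)
      have "diameter_bound k I k"
        unfolding diameter_bound_def
      proof (intro allI impI ballI, rule ccontr)
        fix P :: "(real ^ 'n) set" and u v
        assume P: "cube_polytope k I P" "u \<in> polytope_vertices P" "v \<in> polytope_vertices P"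
          and far: "\<not> reaches (polytope_edges P) k u v"
        have "diameter_bound k (I - {i}) 1" if "i \<in> I" for i using IH[of "{i}"] f1 that by simp
        then have "distant_vertices k I P u v"
          by (rule distant_verticesI[OF P far]) simp_all
        then show False using distant_vertices.reaches_in_polygon[OF _ ij k4] far by blast
      qed
      then show ?thesis using False 3 by (simp add: numeral_2_eq_2)
    qed
  next
    case 4
    have ne: "I \<noteq> {}" using 4 by auto
    have val: "diameter_value k (card I) = 2 * k" by (simp add: 4 numeral_3_eq_3)
    show ?thesis
    proof (cases "k = 3")
      case True
      have "f 1 + k \<le> 2 * k + 1" "f 2 + 2 * k \<le> 2 * k + 1"
        using True by (simp_all add: f_def 4 numeral_eq_Suc)
      then show ?thesis
        unfolding val diameter_bound_def using reaches_if_pairs_bounded[OF _ _ _ _ ne IH] k by force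
    next
      case False
      then have "f 1 + k \<le> 2 * k" by (simp add: f_def 4 numeral_eq_Suc)
      then show ?thesis unfolding val using facet ne by blast
    qed
  next
    case (5 m)
    have ne: "I \<noteq> {}" and card3: "3 \<le> card I" using 5 by auto
    have "f 1 = diameter_value k (m + 3)" "f 2 = diameter_value k (m + 2)"
      "f 3 = diameter_value k (m + 1)"
      by (simp_all add: f_def 5 eval_nat_numeral)
    then consider "f 1 + k \<le> diameter_value k (card I)"
      | "f 1 + k \<le> diameter_value k (card I) + 1" "f 2 + 2 * k \<le> diameter_value k (card I) + 2"
        "f 3 + 3 * k \<le> diameter_value k (card I) + 2"
      using diameter_value_increments[OF k, of m] unfolding 5 by auto
    then show ?thesis
    proof cases
      case 1
      then show ?thesis using facet ne by blast
    next
      case 2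
      show ?thesis
        unfolding diameter_bound_def
      proof (intro allI impI ballI)
        fix P :: "(real ^ 'n) set" and u v
        assume P: "cube_polytope k I P" "u \<in> polytope_vertices P" "v \<in> polytope_vertices P"
        show "reaches (polytope_edges P) (diameter_value k (card I)) u v"
          by (rule reaches_if_spread[OF P k card3 IH 2])
      qed
    qed
  qed
qed

lemma delta_le_diameter_value:
  assumes k: "3 \<le> k"
  shows "delta TYPE('n::finite) k \<le> enat (diameter_value k CARD('n))"
  unfolding delta_def
proof (rule SUP_least)
  fix P :: "(real ^ 'n) set" assume "P \<in> {P. lattice_polytope k P}"
  then have "cube_polytope k UNIV P"
    unfolding lattice_polytope_def cube_polytope_def polytope_vertices_def polytope_def by auto
  then show "polytope_diameter P \<le> enat (diameter_value k CARD('n))"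
    using diameter_bound_value[OF k, of "UNIV :: 'n set"]
    unfolding polytope_diameter_def diameter_bound_def by (intro graph_diameter_le) blast
qed

lemma ceiling_shift: "\<lceil>2 * real (Suc (Suc (Suc (Suc m)))) / 3\<rceil> = \<lceil>2 * real (Suc m) / 3\<rceil> + 2"
proof -
  have "2 * real (Suc (Suc (Suc (Suc m)))) / 3 = 2 * real (Suc m) / 3 + of_int 2" by simp
  then show ?thesis by (simp only: ceiling_add_of_int)
qed

lemma floor_shift: "\<lfloor>7 * real (Suc (Suc (Suc (Suc m)))) / 3\<rfloor> = \<lfloor>7 * real (Suc m) / 3\<rfloor> + 7"
proof -
  have "7 * real (Suc (Suc (Suc (Suc m)))) / 3 = 7 * real (Suc m) / 3 + of_int 7" by simp
  then show ?thesis by (simp only: floor_add_int)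
qed

lemma diameter_value_ge_4:
  "4 \<le> k \<Longrightarrow> 1 \<le> d \<Longrightarrow>
    int (diameter_value k d) = int k * int d - \<lceil>2 * real d / 3\<rceil> - (int k - 2)"
proof (induction k d rule: diameter_value.induct)
  case (5 k m)
  then have "int (diameter_value k (Suc m)) = int k * int (Suc m) - \<lceil>2 * real (Suc m) / 3\<rceil> - (int k - 2)"
    by simp
  then show ?case
    using 5(2) unfolding ceiling_shift by (simp add: algebra_simps of_nat_diff)
qed (auto simp: algebra_simps ceiling_eq_iff)

lemma diameter_value_3:
  "1 \<le> d \<Longrightarrow> int (diameter_value 3 d) =
    (if d mod 3 = 2 then \<lfloor>7 * real d / 3\<rfloor> else \<lfloor>7 * real d / 3\<rfloor> - 1)"
proof (induction "3 :: nat" d rule: diameter_value.induct)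
  case (5 m)
  have mod: "Suc (Suc (Suc (Suc m))) mod 3 = Suc m mod 3" by presburger
  have "int (diameter_value 3 (Suc m)) =
      (if Suc m mod 3 = 2 then \<lfloor>7 * real (Suc m) / 3\<rfloor> else \<lfloor>7 * real (Suc m) / 3\<rfloor> - 1)"
    by (rule 5) simp
  then show ?case unfolding floor_shift mod by (simp del: of_nat_Suc)
next
  case 3
  have "\<lfloor>7 * real (Suc (Suc 0)) / 3\<rfloor> = 4" by (simp add: floor_eq_iff)
  then show ?case by simp
next
  case 4
  have "\<lfloor>7 * real (Suc (Suc (Suc 0))) / 3\<rfloor> = 7" by (simp add: floor_eq_iff)
  then show ?case by simp
qed (simp_all add: floor_eq_iff)

theorem theorem1p2:
  fixes d :: nat
  assumes "d = CARD('n::finite)"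
  shows "(\<forall>k::nat. k \<ge> 4 \<longrightarrow>
            ereal_of_enat (delta TYPE('n) k)
              \<le> ereal (of_int (int k * int d - \<lceil>2 * real d / 3\<rceil> - (int k - 2)))) \<and>
         (d mod 3 \<noteq> 2 \<longrightarrow>
            ereal_of_enat (delta TYPE('n) 3) \<le> ereal (of_int (\<lfloor>7 * real d / 3\<rfloor> - 1))) \<and>
         (d mod 3 = 2 \<longrightarrow>
            ereal_of_enat (delta TYPE('n) 3) \<le> ereal (of_int \<lfloor>7 * real d / 3\<rfloor>))"
proof -
  have d: "1 \<le> d" using assms by (simp add: Suc_leI)
  have le: "ereal_of_enat (delta TYPE('n) k) \<le> ereal (of_int (int (diameter_value k d)))"
    if "3 \<le> k" for k
  proof -
    have "ereal_of_enat (delta TYPE('n) k) \<le> ereal_of_enat (enat (diameter_value k d))"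
      using delta_le_diameter_value[OF that, where 'n = 'n] unfolding assms
      by (simp only: ereal_of_enat_le_iff)
    then show ?thesis by simp
  qed
  show ?thesis
  proof (intro conjI allI impI)
    fix k :: nat assume k: "4 \<le> k"
    then have "3 \<le> k" by simp
    from le[OF this] show "ereal_of_enat (delta TYPE('n) k)
        \<le> ereal (of_int (int k * int d - \<lceil>2 * real d / 3\<rceil> - (int k - 2)))"
      unfolding diameter_value_ge_4[OF k d] .
  next
    assume "d mod 3 \<noteq> 2"
    then show "ereal_of_enat (delta TYPE('n) 3) \<le> ereal (of_int (\<lfloor>7 * real d / 3\<rfloor> - 1))"
      using le[of 3] diameter_value_3[OF d] by simp
  next
    assume "d mod 3 = 2"
    then show "ereal_of_enat (delta TYPE('n) 3) \<le> ereal (of_int \<lfloor>7 * real d / 3\<rfloor>)"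
      using le[of 3] diameter_value_3[OF d] by simp
  qed
qed

end
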